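(* Let $$R(z)=\sum_{j=1}^n\frac{a_j}{z-p_j}$$ be a rational map of degree $n$ whose poles $p_1,\dots,p_n$ are distinct and real and whose residues $a_1,\dots,a_n$ are real and nonzero, and suppose that $R^{-1}(\mathbb{D})$ is an $n$-connected domain. Then $R$ is a rational Ahlfors function if and only if all of its residues $a_1,\dots,a_n$ are positive.
   Context: $\widehat{\mathbb{C}}$ is the Riemann sphere and $\mathbb{D}=\{z\in\mathbb{C}:|z|<1\}$ is the open unit disk. For a rational map $R$, $R^{-1}(\mathbb{D})=\{z\in\widehat{\mathbb{C}}:|R(z)|<1\}$. A domain $X\subset\widehat{\mathbb{C}}$ is $n$-connected if $\widehat{\mathbb{C}}\setminus X$ has exactly $n$ connected components. Ahlfors function: let $X\subset\widehat{\mathbb{C}}$ be a domain containing $\infty$. For holomorphic $f:X\to\mathbb{C}$, put $f'(\infty):=\lim_{z\to\infty}z(f(z)-f(\infty))$. The Ahlfors function on $X$ is the unique function maximizing $\mathrm{Re}\,f'(\infty)$ among all holomorphic $f:X\to\mathbb{D}$ with $f(\infty)=0$. A rational map $R$ of degree $n$ is called $n$-good if $R(\infty)=0$, $R^{-1}(\mathbb{D})$ is connected, and $R^{-1}(\widehat{\mathbb{C}}\setminus\mathbb{D})$ has exactly $n$ connected components. A rational Ahlfors function (of degree $n$) is an $n$-good rational map $R$ whose restriction to $R^{-1}(\mathbb{D})$ is the Ahlfors function on $R^{-1}(\mathbb{D})$. *)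

theory Defs
  imports "HOL-Complex_Analysis.Complex_Analysis" "HOL-Computational_Algebra.Polynomial"
begin

text \<open>A point of the Riemann sphere is \<open>Some z\<close> with \<open>z\<close> complex, or \<open>None\<close>, which stands
  for infinity.\<close>

type_synonym sphere = "complex option"

definition sphere_top :: "sphere topology" where
  "sphere_top = Alexandroff_compactification euclidean"

definition sphere_disk :: "sphere set" where
  "sphere_disk = Some ` ball 0 1"

definition sphere_domain :: "sphere set \<Rightarrow> bool" where
  "sphere_domain X \<longleftrightarrow> openin sphere_top X \<and> connectedin sphere_top X \<and> X \<noteq> {}"

definition has_n_components :: "nat \<Rightarrow> sphere set \<Rightarrow> bool" where
  "has_n_components n S \<longleftrightarrow>
     finite (connected_components_of (subtopology sphere_top S)) \<and>
     card (connected_components_of (subtopology sphere_top S)) = n"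

definition n_connected_domain :: "nat \<Rightarrow> sphere set \<Rightarrow> bool" where
  "n_connected_domain n X \<longleftrightarrow> sphere_domain X \<and> has_n_components n (- X)"

definition chart_at_infinity :: "complex \<Rightarrow> sphere" where
  "chart_at_infinity w = (if w = 0 then None else Some (1 / w))"

text \<open>Holomorphy of a finite-valued function on an open subset of the sphere, in the two standard
  charts. Only the values of \<open>f\<close> on \<open>X\<close> matter.\<close>

definition sphere_holomorphic_on :: "(sphere \<Rightarrow> complex) \<Rightarrow> sphere set \<Rightarrow> bool" where
  "sphere_holomorphic_on f X \<longleftrightarrow>
     (f \<circ> Some) holomorphic_on (Some -` X) \<and>
     (f \<circ> chart_at_infinity) holomorphic_on (chart_at_infinity -` X)"

definition deriv_at_infinity :: "(sphere \<Rightarrow> complex) \<Rightarrow> complex" where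
  "deriv_at_infinity f = Lim at_infinity (\<lambda>z. z * (f (Some z) - f None))"

definition ahlfors_competitor :: "sphere set \<Rightarrow> (sphere \<Rightarrow> complex) \<Rightarrow> bool" where
  "ahlfors_competitor X f \<longleftrightarrow>
     sphere_holomorphic_on f X \<and> f ` X \<subseteq> ball 0 1 \<and> f None = 0"

definition ahlfors_maximizer :: "sphere set \<Rightarrow> (sphere \<Rightarrow> complex) \<Rightarrow> bool" where
  "ahlfors_maximizer X f \<longleftrightarrow>
     ahlfors_competitor X f \<and>
     (\<forall>g. ahlfors_competitor X g \<longrightarrow> Re (deriv_at_infinity g) \<le> Re (deriv_at_infinity f))"

text \<open>Functions are total in HOL, so uniqueness of the maximizer means uniqueness of its
  restriction to \<open>X\<close>.\<close>

definition is_ahlfors_function :: "sphere set \<Rightarrow> (sphere \<Rightarrow> complex) \<Rightarrow> bool" where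
  "is_ahlfors_function X f \<longleftrightarrow>
     sphere_domain X \<and> None \<in> X \<and>
     ahlfors_maximizer X f \<and>
     (\<forall>g. ahlfors_maximizer X g \<longrightarrow> (\<forall>x\<in>X. g x = f x))"

text \<open>The map of the sphere induced by \<open>P / Q\<close>, for coprime \<open>P\<close> and \<open>Q\<close> with \<open>Q\<close> nonzero. If
  \<open>degree P < degree Q\<close> then \<open>coeff P (degree Q) = 0\<close>, so the value at infinity is \<open>0\<close>.\<close>

definition rational_fun :: "complex poly \<Rightarrow> complex poly \<Rightarrow> sphere \<Rightarrow> sphere" where
  "rational_fun P Q x = (case x of
      Some z \<Rightarrow> if poly Q z = 0 then None else Some (poly P z / poly Q z)
    | None \<Rightarrow> if degree Q < degree P then None
              else Some (coeff P (degree Q) / lead_coeff Q))"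

definition rational_map :: "nat \<Rightarrow> (sphere \<Rightarrow> sphere) \<Rightarrow> bool" where
  "rational_map n R \<longleftrightarrow>
     (\<exists>P Q. Q \<noteq> 0 \<and> coprime P Q \<and> max (degree P) (degree Q) = n \<and> R = rational_fun P Q)"

definition n_good :: "nat \<Rightarrow> (sphere \<Rightarrow> sphere) \<Rightarrow> bool" where
  "n_good n R \<longleftrightarrow>
     rational_map n R \<and> R None = Some 0 \<and>
     connectedin sphere_top (R -` sphere_disk) \<and>
     has_n_components n (R -` (- sphere_disk))"

text \<open>On \<open>R -` sphere_disk\<close> the map \<open>R\<close> is finite-valued, and \<open>the \<circ> R\<close> is \<open>R\<close> viewed as a
  complex-valued function there.\<close>

definition rational_ahlfors_function :: "(sphere \<Rightarrow> sphere) \<Rightarrow> bool" where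
  "rational_ahlfors_function R \<longleftrightarrow>
     (\<exists>n. n_good n R \<and> is_ahlfors_function (R -` sphere_disk) (the \<circ> R))"

end

theory Submission
  imports Defs
begin

text \<open>Write \<open>L w = Ln ((1 + w) / (1 - w))\<close>, which maps the unit disc onto the strip
  \<open>\<bar>Im\<bar> < \<pi> / 2\<close>, and let \<open>U\<close> be the part of the domain \<open>X\<close> in the upper half plane.

  If all residues are positive, then \<open>Im R \<le> 0\<close> on the upper half plane, so \<open>Im L(R)\<close> has
  boundary values \<open>- \<pi> / 2\<close> on \<open>{\<bar>R\<bar> = 1}\<close> and \<open>0\<close> on the real axis. A competitor \<open>g\<close> that is real on the
  real axis therefore satisfies \<open>Im L(g) \<ge> Im L(R)\<close> on \<open>U\<close>, and comparison at infinity gives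
  \<open>g'(\<infinity>) \<le> R'(\<infinity>)\<close>; a general competitor is symmetrized by averaging \<open>L(g)\<close> with its reflection.
  Equality forces the symmetrization of \<open>L(g)\<close> to be \<open>L(R)\<close>, and a second use of the maximum
  principle gives \<open>g = R\<close>.

  Conversely \<open>U\<close> is simply connected, because by the maximum principle every component of
  \<open>{\<bar>R\<bar> \<ge> 1}\<close> contains a pole, which is real. Transporting the problem to the disc yields the greatest
  harmonic minorant of \<open>min 0 (Im L(R))\<close> on \<open>U\<close>. It vanishes on the real axis, and Schwarz reflection
  turns it into \<open>Im L(g)\<close> for a competitor \<open>g\<close> with \<open>g'(\<infinity>) \<ge> R'(\<infinity>)\<close>. If \<open>R\<close> is extremal, equality holds,
  hence \<open>L(g) = L(R)\<close> and \<open>Im R \<le> 0\<close> on \<open>U\<close>. Then \<open>Im R \<le> 0\<close> on the whole upper half plane,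
  and the behaviour at the poles shows that the residues are positive.\<close>

section \<open>Maximum principle and expansions at infinity\<close>

text \<open>Competitors are compared through \<open>Im L\<close>, and averaging is allowed because
  the strip is convex. No regularity of {|R| = 1} is available, and \<open>Im L(R)\<close> jumps
  where \<open>R\<close> is 1 or -1. The boundary therefore enters only through the one-sided strip
  bound and a logarithmic barrier, and maximum principles are reduced to the maximum modulus of an
  exponential on a compact superlevel set. Infinity is a boundary point of the half plane. The
  inequality of derivatives is thus a Hopf-type statement: a difference whose imaginary part has one
  sign either has a nonzero derivative there or vanishes identically. This settles extremality and
  its equality case together. In the converse the minorant must lie below \<open>Im L(R)\<close>, so
  that its derivative is at least that of \<open>R\<close>, and below 0, so that equality hands over
  the sign of \<open>Im R\<close>. It is built on \<open>U\<close> because harmonic functions on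
  \<open>X\<close> may have conjugates with periods; reflection then gives a single-valued function
  on \<open>X\<close>.\<close>

lemma compact_superlevel_empty:
  assumes "open W" "E holomorphic_on W" "compact {z \<in> W. c \<le> cmod (E z)}" "z \<in> W"
  shows "cmod (E z) < c"
proof (rule ccontr)
  define K where "K = {z \<in> W. c \<le> cmod (E z)}"
  assume "\<not> cmod (E z) < c"
  then have "K \<noteq> {}"
    using assms(4) by (auto simp: K_def)
  moreover have "continuous_on K (\<lambda>z. cmod (E z))"
    by (intro continuous_intros holomorphic_on_imp_continuous_on holomorphic_on_subset[OF assms(2)])
       (auto simp: K_def)
  ultimately obtain z1 where z1: "z1 \<in> K" "\<And>y. y \<in> K \<Longrightarrow> cmod (E y) \<le> cmod (E z1)"
    using assms(3) continuous_attains_sup[of K] unfolding K_def by blast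
  \<comment> \<open>Outside \<open>K\<close> the modulus is below \<open>c\<close>, hence below its
    value at \<open>z1\<close>, so \<open>z1\<close> maximizes over all of \<open>C\<close>.
    Constancy puts \<open>C\<close>, and then its closure, into \<open>K\<close>; so
    \<open>C\<close> is open and closed.\<close>
  define C where "C = connected_component_set W z1"
  have "z1 \<in> W"
    using z1(1) by (simp add: K_def)
  have C: "open C" "connected C" "C \<subseteq> W" "z1 \<in> C"
    using assms(1) \<open>z1 \<in> W\<close> by (auto simp: C_def open_connected_component connected_component_subset)
  have "E constant_on C"
  proof (rule maximum_modulus_principle[where U = C])
    fix y assume "y \<in> C"
    show "cmod (E y) \<le> cmod (E z1)"
      using z1 C(3) \<open>y \<in> C\<close> by (cases "y \<in> K") (auto simp: K_def)
  qed (use C holomorphic_on_subset[OF assms(2)] in auto)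
  then have "C \<subseteq> K"
    using C z1(1) by (fastforce simp: constant_on_def K_def)
  then have "closure C \<subseteq> K"
    using assms(3) by (simp add: K_def closure_minimal compact_imp_closed)
  then have "closure C \<subseteq> C"
    unfolding C_def
    by (intro connected_component_maximal)
       (use C(2,4) closure_subset[of C] K_def connected_imp_connected_closure[of C] in \<open>auto simp: C_def\<close>)
  then have "closed C"
    using closure_subset_eq by blast
  then have "C = UNIV"
    using C clopen[of C] by blast
  then show False
    using \<open>C \<subseteq> K\<close> compact_imp_bounded[OF assms(3)] K_def bounded_subset not_bounded_UNIV by metis
qed

text \<open>In the coordinate \<open>w = inverse z\<close> the limit is a removable singularity, and
  \<open>z * (F z - l)\<close> becomes the difference quotient of the extension at 0.\<close>

lemma holomorphic_extension_at_infinity: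
  fixes F :: "complex \<Rightarrow> complex"
  assumes "0 < R" "F holomorphic_on {z. R < cmod z}" "(F \<longlongrightarrow> l) at_infinity"
  defines "f \<equiv> \<lambda>w. if w = 0 then l else F (inverse w)"
  shows "f holomorphic_on ball 0 (1 / R)"
    and "((\<lambda>z. z * (F z - l)) \<longlongrightarrow> deriv f 0) at_infinity"
proof -
  have "(\<lambda>w. F (inverse w)) holomorphic_on ball 0 (1/R) - {0}"
  proof (rule holomorphic_on_compose[OF _ holomorphic_on_subset[OF assms(2)], of inverse, unfolded o_def])
    show "inverse holomorphic_on ball 0 (1/R) - {0}"
      by (intro holomorphic_intros) auto
    show "inverse ` (ball 0 (1/R) - {0}) \<subseteq> {z. R < cmod z}"
      using assms(1) by (auto simp: norm_divide divide_simps mult.commute)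
  qed
  moreover have "((\<lambda>w. F (inverse w)) \<longlongrightarrow> l) (at 0)"
    using assms(3) by (simp add: lim_at_infinity_0 o_def)
  ultimately show hol: "f holomorphic_on ball 0 (1 / R)"
    unfolding f_def by (intro removable_singularity) auto
  have "(f has_field_derivative deriv f 0) (at 0)"
    using assms(1) by (intro holomorphic_derivI[OF hol]) auto
  then have "((\<lambda>w. (f w - f 0) / (w - 0)) \<longlongrightarrow> deriv f 0) (at 0)"
    by (simp add: has_field_derivative_iff)
  then have "((\<lambda>w. inverse w * (F (inverse w) - l)) \<longlongrightarrow> deriv f 0) (at 0)"
    by (rule Lim_transform_eventually) (auto simp: eventually_at_filter f_def divide_inverse mult.commute)
  then show "((\<lambda>z. z * (F z - l)) \<longlongrightarrow> deriv f 0) at_infinity"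
    by (simp add: lim_at_infinity_0 o_def)
qed

text \<open>If the zero at \<open>0\<close> has order \<open>k\<close>, then on small half circles \<open>Im f\<close> has the sign of
  \<open>Im (w ^ k * g 0)\<close>, which is constant on a half plane only for \<open>k = 1\<close>.\<close>

lemma half_plane_boundary_derivative:
  assumes "f holomorphic_on ball 0 \<rho>" "0 < \<rho>" "f 0 = 0"
    and "\<And>w. w \<in> ball 0 \<rho> \<Longrightarrow> Im w < 0 \<Longrightarrow> 0 \<le> Im (f w)"
  shows "(\<forall>w\<in>ball 0 \<rho>. f w = 0) \<or> Re (deriv f 0) < 0"
proof (cases "f constant_on ball 0 \<rho>")
  case True
  then show ?thesis
    using assms(2,3) by (metis centre_in_ball constant_on_def)
next
  case False
  obtain g s k where gk: "0 < (k::nat)" "0 < s" "ball 0 s \<subseteq> ball (0::complex) \<rho>"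
      "g holomorphic_on ball 0 s" "\<And>w. w \<in> ball 0 s \<Longrightarrow> f w = w^k * g w"
      "\<And>w. w \<in> ball 0 s \<Longrightarrow> g w \<noteq> 0"
    using holomorphic_factor_zero_nonconstant[OF assms(1) open_ball connected_ball _ assms(3) False]
      assms(2) by (metis centre_in_ball diff_zero)
  have g0: "g 0 \<noteq> 0" and gc: "isCont g 0"
    using gk by (auto simp: holomorphic_on_imp_continuous_on continuous_on_eq_continuous_at
        intro!: continuous_on_interior[OF holomorphic_on_imp_continuous_on[OF gk(4)]])
  have neg: "0 \<le> Im (\<omega>^k * g 0)" if "Im \<omega> < 0" for \<omega>
  proof -
    have lim: "((\<lambda>t. of_real t * \<omega>) \<longlongrightarrow> 0) (at_right (0::real))"
      by (rule tendsto_eq_intros refl)+ auto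
    have "((\<lambda>t. Im (\<omega>^k * g (of_real t * \<omega>))) \<longlongrightarrow> Im (\<omega>^k * g 0)) (at_right (0::real))"
      by (intro tendsto_intros isCont_tendsto_compose[OF gc] lim)
    moreover have "eventually (\<lambda>t. 0 \<le> Im (\<omega>^k * g (of_real t * \<omega>))) (at_right (0::real))"
    proof -
      have "eventually (\<lambda>t. of_real t * \<omega> \<in> ball 0 s) (at_right (0::real))"
        using lim gk(2) by (intro topological_tendstoD) auto
      moreover have "eventually (\<lambda>t::real. 0 < t) (at_right 0)"
        by (simp add: eventually_at_right_less)
      ultimately show ?thesis
      proof eventually_elim
        case (elim t)
        have "0 \<le> Im (f (of_real t * \<omega>))"
          using elim that gk(3) by (intro assms(4)) (auto simp: mult_pos_neg)
        also have "f (of_real t * \<omega>) = of_real (t^k) * (\<omega>^k * g (of_real t * \<omega>))"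
          using gk(5)[OF elim(1)] by (simp add: power_mult_distrib)
        finally have "0 \<le> t^k * Im (\<omega>^k * g (of_real t * \<omega>))"
          by (simp add: algebra_simps del: of_real_power)
        then show ?case
          using zero_less_power[OF elim(2), of k] zero_le_mult_iff not_le by metis
      qed
    qed
    ultimately show ?thesis
      by (intro tendsto_lowerbound) auto
  qed
  \<comment> \<open>The root chosen below can be real, so the inequality is extended to the closed
    half plane.\<close>
  have nonpos: "0 \<le> Im (\<omega>^k * g 0)" if "Im \<omega> \<le> 0" for \<omega>
  proof -
    have "((\<lambda>t. Im ((\<omega> - \<i> * of_real t)^k * g 0)) \<longlongrightarrow> Im ((\<omega> - \<i> * of_real 0)^k * g 0)) (at_right (0::real))"
      by (intro tendsto_intros)
    moreover have "eventually (\<lambda>t. 0 \<le> Im ((\<omega> - \<i> * of_real t)^k * g 0)) (at_right (0::real))"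
      using eventually_at_right_less by (rule eventually_mono) (intro neg, use that in auto)
    ultimately show ?thesis
      by (intro tendsto_lowerbound[where f = "\<lambda>t. Im ((\<omega> - \<i> * of_real t)^k * g 0)"]) auto
  qed
  have k1: "k = 1"
  proof (rule ccontr)
    assume "k \<noteq> 1"
    then have "2 \<le> k"
      using gk(1) by simp
    \<comment> \<open>For \<open>k \<ge> 2\<close> the closed lower half plane contains a
      \<open>k\<close>-th root of every number: writing the argument as \<open>-\<alpha>\<close>
      with \<open>\<alpha>\<close> in [0, 2 pi), the root has argument
      \<open>-\<alpha> / k \<ge> - pi\<close>. The target \<open>\<tau>\<close> makes
      \<open>\<omega>^k * g 0\<close> equal to \<open>- \<i>\<close>, which contradicts the
      sign.\<close>
    define \<tau> where "\<tau> = - \<i> / g 0"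
    define \<alpha> where "\<alpha> = Arg2pi (cnj \<tau>)"
    define \<omega> where "\<omega> = of_real (root k (cmod \<tau>)) * exp (- \<i> * of_real (\<alpha> / k))"
    have \<alpha>: "0 \<le> \<alpha>" "\<alpha> < 2 * pi" "cnj \<tau> = of_real (cmod \<tau>) * exp (\<i> * of_real \<alpha>)"
      using Arg2pi[of "cnj \<tau>"] by (auto simp: \<alpha>_def is_Arg_def)
    have "\<alpha> / k \<le> \<alpha> / 2"
      using \<alpha>(1) \<open>2 \<le> k\<close> by (intro divide_left_mono) auto
    then have "\<alpha> / k \<le> pi"
      using \<alpha> by linarith
    then have "Im \<omega> \<le> 0"
      using \<alpha>(1) by (auto simp: \<omega>_def Im_exp intro!: mult_nonneg_nonneg sin_ge_zero real_root_ge_zero)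
    moreover have "\<omega>^k = \<tau>"
    proof -
      have "\<omega>^k = of_real (root k (cmod \<tau>) ^ k) * exp (of_nat k * (- \<i> * of_real (\<alpha> / k)))"
        unfolding \<omega>_def power_mult_distrib exp_of_nat_mult by simp
      also have "\<dots> = of_real (cmod \<tau>) * exp (- \<i> * of_real \<alpha>)"
        using gk(1) by simp
      also have "\<dots> = cnj (cnj \<tau>)"
        unfolding \<alpha>(3) by (simp add: exp_cnj)
      finally show ?thesis by simp
    qed
    ultimately show False
      using nonpos[of \<omega>] g0 by (simp add: \<tau>_def)
  qed
  have "((\<lambda>w. w * g w) has_field_derivative (1 * g 0 + deriv g 0 * 0)) (at 0)"
    using gk(2) by (intro DERIV_mult DERIV_ident holomorphic_derivI[OF gk(4)]) auto
  then have "(f has_field_derivative g 0) (at 0)"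
    using gk(2,5) k1 by (auto intro: has_field_derivative_transform_within_open[of _ _ _ "ball 0 s"])
  then have "deriv f 0 = g 0"
    by (rule DERIV_imp_deriv)
  moreover have "Im (g 0) = 0" "Re (g 0) \<le> 0"
    using nonpos[of 1] nonpos[of "-1"] nonpos[of "-\<i>"] k1 by auto
  ultimately show ?thesis
    using g0 by (metis complex_eqI less_le zero_complex.simps)
qed

text \<open>Inversion exchanges the half planes, which is why the local version speaks of
  \<open>Im w < 0\<close>. The sign of \<open>c\<close> is that of the model case:
  \<open>c / z\<close> has nonnegative imaginary part on the upper half plane for negative real
  \<open>c\<close>.\<close>

lemma half_plane_boundary_derivative_at_infinity:
  fixes F :: "complex \<Rightarrow> complex"
  assumes "0 < R" "F holomorphic_on {z. R < cmod z}" "(F \<longlongrightarrow> 0) at_infinity"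
    and "\<And>z. R < cmod z \<Longrightarrow> 0 < Im z \<Longrightarrow> 0 \<le> Im (F z)"
    and "((\<lambda>z. z * F z) \<longlongrightarrow> c) at_infinity"
  shows "(\<forall>z. R < cmod z \<longrightarrow> F z = 0) \<or> Re c < 0"
proof -
  define f where "f = (\<lambda>w. if w = 0 then 0 else F (inverse w))"
  note ext = holomorphic_extension_at_infinity[OF assms(1-3), folded f_def]
  have "c = deriv f 0"
    using ext(2) assms(5) by (intro tendsto_unique[OF trivial_limit_at_infinity]) auto
  moreover have "(\<forall>w\<in>ball 0 (1/R). f w = 0) \<or> Re (deriv f 0) < 0"
  proof (rule half_plane_boundary_derivative[OF ext(1)])
    fix w :: complex assume w: "w \<in> ball 0 (1/R)" "Im w < 0"
    then have "R < cmod (inverse w)"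
      using assms(1) by (auto simp: norm_divide divide_simps mult.commute)
    moreover have "0 < Im (inverse w)"
      using w(2) by (auto simp: divide_neg_pos sum_power2_gt_zero_iff)
    ultimately have "R < cmod (inverse w)" "0 < Im (inverse w)"
      by blast+
    then show "0 \<le> Im (f w)"
      using w assms(4) by (auto simp: f_def)
  qed (use assms(1) in \<open>auto simp: f_def\<close>)
  moreover have "\<forall>z. R < cmod z \<longrightarrow> F z = 0" if 0: "\<forall>w\<in>ball 0 (1/R). f w = 0"
  proof (intro allI impI)
    fix z assume z: "R < cmod z"
    then have "inverse z \<in> ball 0 (1/R)" "z \<noteq> 0"
      using assms(1) by (auto simp: norm_divide divide_simps mult.commute)
    then show "F z = 0"
      using 0 by (force simp: f_def)
  qed
  ultimately show ?thesis by blast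
qed

section \<open>The conformal map of the disc onto a strip\<close>

text \<open>This is twice the principal inverse hyperbolic tangent. It is also evaluated outside the
  unit disc, where it serves as a harmonic measure of the half plane.\<close>

definition cayley_log :: "complex \<Rightarrow> complex" where
  "cayley_log w = Ln ((1 + w) / (1 - w))"

lemma Re_cayley: "Re ((1 + w) / (1 - w)) = (1 - (cmod w)\<^sup>2) / (cmod (1 - w))\<^sup>2"
  by (simp add: Re_divide cmod_power2) (simp add: power2_eq_square algebra_simps)

lemma Im_cayley: "Im ((1 + w) / (1 - w)) = 2 * Im w / (cmod (1 - w))\<^sup>2"
  by (simp add: Im_divide cmod_power2) (simp add: power2_eq_square algebra_simps)

lemma Re_cayley_pos:
  assumes "cmod w < 1"
  shows "0 < Re ((1 + w) / (1 - w))"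
proof -
  have "w \<noteq> 1" "(cmod w)\<^sup>2 < 1"
    using assms by (auto simp: abs_square_less_1)
  then show ?thesis
    unfolding Re_cayley by auto
qed

lemma cayley_not_nonpos: "cmod w < 1 \<Longrightarrow> (1 + w) / (1 - w) \<notin> \<real>\<^sub>\<le>\<^sub>0"
  using Re_cayley_pos[of w] by (auto simp: complex_nonpos_Reals_iff)

lemma cayley_nonzero: "cmod w < 1 \<Longrightarrow> (1 + w) / (1 - w) \<noteq> 0"
  using Re_cayley_pos[of w] by auto

lemma cayley_log_0 [simp]: "cayley_log 0 = 0"
  by (simp add: cayley_log_def)

lemma exp_cayley_log: "cmod w < 1 \<Longrightarrow> exp (cayley_log w) = (1 + w) / (1 - w)"
  unfolding cayley_log_def by (rule exp_Ln) (rule cayley_nonzero)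

lemma cayley_log_inject:
  assumes "cmod v < 1" "cmod w < 1" "cayley_log v = cayley_log w"
  shows "v = w"
proof -
  have "v \<noteq> 1" "w \<noteq> 1"
    using assms by auto
  moreover have "(1 + v) / (1 - v) = (1 + w) / (1 - w)"
    using assms exp_cayley_log by metis
  ultimately show ?thesis
    by (simp add: divide_simps) algebra
qed

lemma cayley_log_cnj: "cmod w < 1 \<Longrightarrow> cayley_log (cnj w) = cnj (cayley_log w)"
  unfolding cayley_log_def using cnj_Ln[OF cayley_not_nonpos, of w] by simp

lemma Im_cayley_log_less: "cmod w < 1 \<Longrightarrow> \<bar>Im (cayley_log w)\<bar> < pi / 2"
  unfolding cayley_log_def using Re_Ln_pos_lt_imp[OF Re_cayley_pos] by blast

lemma Im_cayley_log_nonpos_iff: "cmod w < 1 \<Longrightarrow> Im (cayley_log w) \<le> 0 \<longleftrightarrow> Im w \<le> 0"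
proof -
  assume w: "cmod w < 1"
  then have "0 < (cmod (1 - w))\<^sup>2"
    by auto
  then have "Im w \<le> 0 \<longleftrightarrow> Im ((1 + w) / (1 - w)) \<le> 0"
    unfolding Im_cayley by (simp add: divide_le_0_iff) 
  also have "\<dots> \<longleftrightarrow> Im (cayley_log w) \<le> 0"
    using Im_Ln_pos_lt[OF cayley_nonzero[OF w]] Im_cayley_log_less[OF w] pi_gt_zero
    unfolding cayley_log_def by linarith
  finally show ?thesis by simp
qed

lemma holomorphic_cayley_log: "cayley_log holomorphic_on ball 0 1"
  unfolding cayley_log_def
  by (intro holomorphic_intros) (auto simp: cayley_not_nonpos)

lemma holomorphic_on_cayley_log [holomorphic_intros]:
  assumes "f holomorphic_on A" "\<And>z. z \<in> A \<Longrightarrow> cmod (f z) < 1"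
  shows "(\<lambda>z. cayley_log (f z)) holomorphic_on A"
  using holomorphic_on_compose_gen[OF assms(1) holomorphic_cayley_log] assms(2)
  by (auto simp: o_def image_subset_iff)

lemma isCont_cayley_log: "cmod w < 1 \<Longrightarrow> isCont cayley_log w"
  using holomorphic_on_imp_continuous_on[OF holomorphic_cayley_log]
  by (simp add: continuous_on_eq_continuous_at)

lemma tendsto_cayley_log_0: "(f \<longlongrightarrow> 0) F \<Longrightarrow> ((\<lambda>z. cayley_log (f z)) \<longlongrightarrow> 0) F"
  using isCont_tendsto_compose[OF isCont_cayley_log[of 0], of f F] by simp

lemma DERIV_cayley_log_0: "(cayley_log has_field_derivative 2) (at 0)"
  unfolding cayley_log_def
  by (rule derivative_eq_intros refl | simp)+

text \<open>The tangent of \<open>cayley_log\<close> at \<open>0\<close> is \<open>2 w\<close>, so derivatives at infinity get doubled.\<close>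

lemma cayley_log_at_infinity:
  assumes "(f \<longlongrightarrow> 0) at_infinity" "((\<lambda>z. z * f z) \<longlongrightarrow> c) at_infinity"
  shows "((\<lambda>z. z * cayley_log (f z)) \<longlongrightarrow> 2 * c) at_infinity"
proof -
  \<comment> \<open>The quotient is completed by its limit at 0 because \<open>f\<close> may have
    zeros arbitrarily far out.\<close>
  define q where "q = (\<lambda>w. if w = 0 then 2 else cayley_log w / w)"
  have "((\<lambda>w. cayley_log w / w) \<longlongrightarrow> 2) (at 0)"
    using DERIV_cayley_log_0 by (simp add: has_field_derivative_iff)
  then have "(q \<longlongrightarrow> 2) (at 0)"
    by (rule Lim_transform_eventually) (auto simp: q_def eventually_at_filter)
  moreover have "q 0 = 2"
    by (simp add: q_def)
  ultimately have "isCont q 0"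
    by (simp add: isCont_def)
  then have "((\<lambda>z. q (f z)) \<longlongrightarrow> q 0) at_infinity"
    using assms(1) by (rule isCont_tendsto_compose)
  then have "((\<lambda>z. q (f z) * (z * f z)) \<longlongrightarrow> q 0 * c) at_infinity"
    by (intro tendsto_intros assms(2))
  moreover have "q w * w = cayley_log w" for w
    by (auto simp: q_def)
  then have "(\<lambda>z. q (f z) * (z * f z)) = (\<lambda>z. z * cayley_log (f z))"
    by (metis mult.assoc mult.commute)
  ultimately show ?thesis
    unfolding q_def by simp
qed

text \<open>The left side is the modulus of the sine of \<open>Im (Ln z)\<close>.\<close>

lemma abs_Im_Ln_ge:
  assumes "z \<noteq> 0"
  shows "\<bar>Im z\<bar> / cmod z \<le> \<bar>Im (Ln z)\<bar>"
proof -
  have "Im z = cmod z * sin (Im (Ln z))"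
    using assms by (metis Im_exp Re_Ln exp_Ln exp_ln zero_less_norm_iff)
  then have "\<bar>Im z\<bar> / cmod z = \<bar>sin (Im (Ln z))\<bar>"
    using assms by (simp add: abs_mult)
  then show ?thesis
    by (simp add: abs_sin_le_one abs_sin_x_le_abs_x)
qed

text \<open>The barrier \<open>\<epsilon> ln (\<bar>1 - w\<^sup>2\<bar> / 2)\<close> compensates the discontinuity of the boundary values
  of \<open>Im (cayley_log w)\<close> at \<open>1\<close> and \<open>-1\<close>.\<close>

lemma cayley_log_barrier:
  assumes "cmod w0 = 1" "0 < \<epsilon>" "0 < \<delta>" "0 \<le> \<kappa>"
  shows "eventually (\<lambda>w. cmod w < 1 \<longrightarrow>
           \<kappa> * (pi / 2 - \<bar>Im (cayley_log w)\<bar>) + \<epsilon> * ln (cmod ((1 - w\<^sup>2) / 2)) < \<delta>) (nhds w0)"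
proof (cases "w0\<^sup>2 = 1")
  case True
  have "((\<lambda>w. cmod ((1 - w\<^sup>2) / 2)) \<longlongrightarrow> cmod ((1 - w0\<^sup>2) / 2)) (nhds w0)"
    by (intro tendsto_intros filterlim_ident) auto
  then have "((\<lambda>w. cmod ((1 - w\<^sup>2) / 2)) \<longlongrightarrow> 0) (nhds w0)"
    using True by simp
  \<comment> \<open>Below this threshold the logarithmic term is less than
    \<open>- \<kappa> * pi / 2\<close>, which outweighs the first summand whatever its
    value.\<close>
  then have "eventually (\<lambda>w. cmod ((1 - w\<^sup>2) / 2) < exp (- \<kappa> * pi / (2 * \<epsilon>))) (nhds w0)"
    by (rule order_tendstoD) auto
  then show ?thesis
  proof (rule eventually_mono, safe)
    fix w assume w: "cmod ((1 - w\<^sup>2) / 2) < exp (- \<kappa> * pi / (2 * \<epsilon>))" "cmod w < 1"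
    have "w\<^sup>2 \<noteq> 1"
      using w(2) by (metis less_irrefl norm_one norm_power power_one_right one_power2 power2_eq_1_iff norm_minus_cancel)
    then have "0 < cmod ((1 - w\<^sup>2) / 2)"
      by simp
    then have "ln (cmod ((1 - w\<^sup>2) / 2)) < - \<kappa> * pi / (2 * \<epsilon>)"
      using w(1) by (metis ln_less_cancel_iff exp_gt_zero ln_exp)
    then have "\<epsilon> * ln (cmod ((1 - w\<^sup>2) / 2)) < - \<kappa> * pi / 2"
      using assms(2) by (simp add: field_simps)
    moreover have "\<kappa> * (pi / 2 - \<bar>Im (cayley_log w)\<bar>) \<le> \<kappa> * (pi / 2)"
      using assms(4) by (intro mult_left_mono) auto
    ultimately show "\<kappa> * (pi / 2 - \<bar>Im (cayley_log w)\<bar>) + \<epsilon> * ln (cmod ((1 - w\<^sup>2) / 2)) < \<delta>"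
      using assms(3) by simp
  qed
next
  case False
  then have ne: "1 - w0 \<noteq> 0" "1 + w0 \<noteq> 0"
    by (auto simp: power2_eq_1_iff eq_neg_iff_add_eq_0 add.commute)
  \<comment> \<open>Away from 1 and -1 the circle is mapped to the imaginary axis without 0, where
    the argument has modulus \<open>pi / 2\<close>. The first summand then tends to 0, and the
    barrier does no harm: it is nonpositive thanks to the divisor 2.\<close>
  have Re0: "Re ((1 + w0) / (1 - w0)) = 0"
    using assms(1) by (simp add: Re_cayley)
  then have "(1 + w0) / (1 - w0) \<notin> \<real>\<^sub>\<le>\<^sub>0"
    using ne by (metis complex_nonpos_Reals_iff divide_eq_0_iff complex_eqI zero_complex.simps)
  moreover have "\<bar>Im (cayley_log w0)\<bar> = pi / 2"
  proof -
    have "(1 + w0) / (1 - w0) \<noteq> 0"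
      using ne by auto
    then show ?thesis
      using Re_Ln_pos_lt[of "(1 + w0) / (1 - w0)"] Re_Ln_pos_le[of "(1 + w0) / (1 - w0)"] Re0
      unfolding cayley_log_def by auto
  qed
  ultimately have "((\<lambda>w. \<kappa> * (pi / 2 - \<bar>Im (cayley_log w)\<bar>)) \<longlongrightarrow> \<kappa> * (pi / 2 - pi / 2)) (nhds w0)"
    using ne unfolding cayley_log_def
    by (auto intro!: tendsto_eq_intros filterlim_ident)
  then have "((\<lambda>w. \<kappa> * (pi / 2 - \<bar>Im (cayley_log w)\<bar>)) \<longlongrightarrow> 0) (nhds w0)"
    by simp
  then have "eventually (\<lambda>w. \<kappa> * (pi / 2 - \<bar>Im (cayley_log w)\<bar>) < \<delta>) (nhds w0)"
    by (rule order_tendstoD) (rule assms(3))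
  then show ?thesis
  proof (rule eventually_mono, safe)
    fix w assume w: "\<kappa> * (pi / 2 - \<bar>Im (cayley_log w)\<bar>) < \<delta>" "cmod w < 1"
    have "cmod (1 - w\<^sup>2) \<le> 1 + (cmod w)\<^sup>2"
      by (metis norm_one norm_power norm_triangle_ineq4)
    also have "(cmod w)\<^sup>2 \<le> 1"
      using w(2) by (simp add: power_le_one)
    finally have "ln (cmod ((1 - w\<^sup>2) / 2)) \<le> 0"
      by (cases "cmod (1 - w\<^sup>2) = 0") (auto simp: norm_divide)
    then have "\<epsilon> * ln (cmod ((1 - w\<^sup>2) / 2)) \<le> 0"
      using assms(2) by (simp add: mult_nonneg_nonpos)
    then show "\<kappa> * (pi / 2 - \<bar>Im (cayley_log w)\<bar>) + \<epsilon> * ln (cmod ((1 - w\<^sup>2) / 2)) < \<delta>"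
      using w(1) by simp
  qed
qed

section \<open>Extremality of functions with nonpositive imaginary part\<close>

text \<open>The extremal problem depends only on symmetry, real poles and the zero at infinity. The
  residues enter later, through the sign of \<open>Im r\<close> on the upper half plane.\<close>

locale real_pole_function =
  fixes P :: "complex set" and r :: "complex \<Rightarrow> complex"
  assumes finite_P: "finite P"
    and P_real: "P \<subseteq> \<real>"
    and holomorphic_r: "r holomorphic_on - P"
    and pole_r: "p \<in> P \<Longrightarrow> filterlim r at_infinity (at p)"
    and r_cnj: "r (cnj z) = cnj (r z)"
    and r_infinity: "(r \<longlongrightarrow> 0) at_infinity"
begin

text \<open>This is the finite part of the domain. Poles are excluded explicitly because
  \<open>r\<close> has arbitrary values there; for a partial fraction sum, division by zero even
  makes them finite.\<close>

definition X :: "complex set" where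
  "X = {z. z \<notin> P \<and> cmod (r z) < 1}"

definition U :: "complex set" where
  "U = X \<inter> {z. 0 < Im z}"

lemma X_norm_less: "z \<in> X \<Longrightarrow> cmod (r z) < 1"
  by (simp add: X_def)

lemma isCont_r: "z \<notin> P \<Longrightarrow> isCont r z"
  using holomorphic_on_imp_continuous_on[OF holomorphic_r] finite_imp_closed[OF finite_P]
  by (simp add: continuous_on_eq_continuous_at open_Compl)

lemma open_X: "open X"
proof -
  have "X = - P \<inter> r -` ball 0 1"
    by (auto simp: X_def)
  then show ?thesis
    using continuous_open_preimage[OF holomorphic_on_imp_continuous_on[OF holomorphic_r]]
      finite_imp_closed[OF finite_P] by (simp add: open_Compl)
qed

lemma open_U: "open U"
  unfolding U_def by (intro open_Int open_X open_halfspace_Im_gt)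

lemma cnj_P_iff: "cnj z \<in> P \<longleftrightarrow> z \<in> P"
  using P_real by (metis Reals_cnj_iff complex_cnj_cnj subsetD)

lemma cnj_X_iff: "cnj z \<in> X \<longleftrightarrow> z \<in> X"
  by (simp add: X_def cnj_P_iff r_cnj)

lemma holomorphic_r_X: "r holomorphic_on X"
  using holomorphic_r by (rule holomorphic_on_subset) (auto simp: X_def)

lemma holomorphic_cayley_log_r: "(\<lambda>z. cayley_log (r z)) holomorphic_on X"
  by (intro holomorphic_intros holomorphic_r_X X_norm_less)

lemma cayley_log_r_infinity: "((\<lambda>z. cayley_log (r z)) \<longlongrightarrow> 0) at_infinity"
  by (rule tendsto_cayley_log_0[OF r_infinity])

lemma Im_cayley_log_r_real: "z \<in> X \<Longrightarrow> Im z = 0 \<Longrightarrow> Im (cayley_log (r z)) = 0"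
  using cayley_log_cnj[OF X_norm_less, of z] r_cnj[of z]
  by (metis Reals_cnj_iff complex_is_Real_iff)

lemma exists_radius: "\<exists>R>0. \<forall>z. R < cmod z \<longrightarrow> z \<in> X"
proof -
  obtain b where b: "\<And>z. b \<le> cmod z \<Longrightarrow> cmod (r z) < 1"
    using r_infinity[unfolded tendsto_iff eventually_at_infinity, rule_format, of 1] by auto
  obtain c where c: "\<And>z. z \<in> P \<Longrightarrow> cmod z \<le> c"
    using finite_imp_bounded[OF finite_P] by (auto simp: bounded_iff)
  show ?thesis
    by (intro exI[of _ "max 1 (max b c)"]) (use b c in \<open>force simp: X_def\<close>)
qed

lemma cmod_one_minus_r_sq_le: "z \<in> X \<Longrightarrow> cmod ((1 - (r z)\<^sup>2) / 2) \<le> 1"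
proof -
  assume "z \<in> X"
  have "cmod (1 - (r z)\<^sup>2) \<le> 1 + (cmod (r z))\<^sup>2"
    by (metis norm_one norm_power norm_triangle_ineq4)
  also have "(cmod (r z))\<^sup>2 \<le> 1"
    using X_norm_less[OF \<open>z \<in> X\<close>] by (simp add: power_le_one)
  finally show ?thesis
    by (simp add: norm_divide)
qed

text \<open>Values in the right half plane make the barrier the real part of a principal logarithm
  that is holomorphic on all of \<open>X\<close>.\<close>

lemma Re_one_minus_r_sq: "z \<in> X \<Longrightarrow> 0 < Re ((1 - (r z)\<^sup>2) / 2)"
proof -
  assume "z \<in> X"
  have "Re ((r z)\<^sup>2) \<le> (cmod (r z))\<^sup>2"
    by (metis complex_Re_le_cmod norm_power)
  also have "\<dots> < 1"
    using X_norm_less[OF \<open>z \<in> X\<close>] by (simp add: abs_square_less_1)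
  finally show ?thesis
    by simp
qed

text \<open>At the boundary of \<open>X\<close> only one inequality is required, and it degenerates at the points
  where \<open>r\<close> takes the values \<open>1\<close> and \<open>-1\<close>; there the barrier takes over.\<close>

lemma boundary_maximum_principle:
  assumes h: "h holomorphic_on X" and W: "W \<subseteq> X" "open W" and "0 \<le> \<kappa>"
    and bound: "\<And>z. z \<in> W \<Longrightarrow> Re (h z) \<le> \<kappa> * (pi / 2 - \<bar>Im (cayley_log (r z))\<bar>)"
    and front: "\<And>z. z \<in> X \<Longrightarrow> z \<in> frontier W \<Longrightarrow> Re (h z) \<le> 0"
    and inf: "((\<lambda>z. Re (h z)) \<longlongrightarrow> 0) at_infinity"
    and "z \<in> W"
  shows "Re (h z) \<le> 0"
proof -
  define B where "B = (\<lambda>z. ln (cmod ((1 - (r z)\<^sup>2) / 2)))"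
  have B_le: "B z \<le> 0" if "z \<in> X" for z
    using cmod_one_minus_r_sq_le[OF that] Re_one_minus_r_sq[OF that] unfolding B_def
    by (subst ln_le_zero_iff) auto
  have step: "Re (h z) + \<epsilon> * B z \<le> ln c" if "0 < \<epsilon>" "1 < c" for \<epsilon> c :: real
  proof -
    define E where "E = (\<lambda>z. exp (h z + of_real \<epsilon> * Ln ((1 - (r z)\<^sup>2) / 2)))"
    have E_norm: "cmod (E z) = exp (Re (h z) + \<epsilon> * B z)" if "z \<in> X" for z
    proof -
      have "(1 - (r z)\<^sup>2) / 2 \<noteq> 0"
        using Re_one_minus_r_sq[OF that] by (metis less_irrefl zero_complex.simps(1))
      from Re_Ln[OF this] show ?thesis
        unfolding E_def B_def norm_exp_eq_Re by simp
    qed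
    have Eh: "E holomorphic_on X"
      unfolding E_def
      by (intro holomorphic_intros h holomorphic_r_X)
         (use Re_one_minus_r_sq complex_nonpos_Reals_iff in fastforce)+
    have c_le: "ln c \<le> Re (h z)" if "z \<in> X" "c \<le> cmod (E z)" for z
    proof -
      have "ln c \<le> Re (h z) + \<epsilon> * B z"
        using that E_norm \<open>1 < c\<close> by (subst exp_le_cancel_iff[symmetric]) simp
      moreover have "\<epsilon> * B z \<le> 0"
        using B_le[OF that(1)] \<open>0 < \<epsilon>\<close> by (simp add: mult_nonneg_nonpos)
      ultimately show ?thesis by simp
    qed
    \<comment> \<open>\<open>K\<close> is compact. It is bounded by the limit of \<open>Re h\<close>
      at infinity. A limit point cannot be a pole or satisfy |r| > 1, since \<open>K\<close> lies in
      \<open>X\<close>; |r| = 1 is excluded by the barrier, and points of \<open>X\<close> on the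
      frontier of \<open>W\<close> by the assumption \<open>front\<close>.\<close>
    define K where "K = {z \<in> W. c \<le> cmod (E z)}"
    have "bounded K"
    proof -
      have "eventually (\<lambda>z. Re (h z) < ln c) at_infinity"
        using inf \<open>1 < c\<close> by (intro order_tendstoD) auto
      then obtain b where "\<And>z. b \<le> cmod z \<Longrightarrow> Re (h z) < ln c"
        by (auto simp: eventually_at_infinity)
      moreover have "ln c \<le> Re (h z)" if "z \<in> K" for z
        using c_le[of z] W(1) that by (auto simp: K_def)
      ultimately have "cmod z \<le> b" if "z \<in> K" for z
        using that by (meson not_le less_imp_le)
      then show ?thesis
        by (auto simp: bounded_iff)
    qed
    moreover have "closed K"
    proof -
      have "x \<in> K" if x: "x \<in> closure K" for x
      proof -
        have freq: "\<not> eventually (\<lambda>y. y \<notin> K) (nhds x)"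
          using x by (auto simp: eventually_nhds closure_iff_nhds_not_empty)
        have Kr: "y \<notin> P" "cmod (r y) < 1" "y \<in> W" "c \<le> cmod (E y)" if "y \<in> K" for y
          using that W(1) by (auto simp: K_def X_def)
        have "x \<notin> P"
        proof
          assume "x \<in> P"
          have "eventually (\<lambda>y. 1 \<le> cmod (r y)) (at x)"
            using pole_r[OF \<open>x \<in> P\<close>] by (simp add: filterlim_at_infinity[of 0])
          then have "eventually (\<lambda>y. y \<notin> K) (nhds x)"
            unfolding eventually_at_filter
            by (rule eventually_mono) (use Kr \<open>x \<in> P\<close> in force)
          then show False using freq by blast
        qed
        then have r_x: "filterlim r (nhds (r x)) (nhds x)"
          using isCont_r[of x] by (simp add: continuous_at_imp_continuous_at_within isCont_def tendsto_at_iff_tendsto_nhds)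
        have "\<not> 1 < cmod (r x)"
        proof
          assume "1 < cmod (r x)"
          then have "eventually (\<lambda>y. 1 < cmod (r y)) (nhds x)"
            using r_x by (intro order_tendstoD(1)[OF tendsto_norm]) auto
          then have "eventually (\<lambda>y. y \<notin> K) (nhds x)"
            by (rule eventually_mono) (use Kr in force)
          then show False using freq by blast
        qed
        moreover have "cmod (r x) \<noteq> 1"
        proof
          assume "cmod (r x) = 1"
          from eventually_compose_filterlim[OF cayley_log_barrier[OF this \<open>0 < \<epsilon>\<close> _ \<open>0 \<le> \<kappa>\<close>, of "ln c"] r_x]
          have "eventually (\<lambda>y. y \<notin> K) (nhds x)"
          proof (rule eventually_mono)
            show "0 < ln c" using \<open>1 < c\<close> by simp
          next
            fix y
            assume y: "cmod (r y) < 1 \<longrightarrow> \<kappa> * (pi / 2 - \<bar>Im (cayley_log (r y))\<bar>)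
                + \<epsilon> * ln (cmod ((1 - (r y)\<^sup>2) / 2)) < ln c"
            show "y \<notin> K"
            proof
              assume "y \<in> K"
              then have "exp (Re (h y) + \<epsilon> * B y) < exp (ln c)"
                using y Kr[of y] bound[of y] by (simp add: B_def)
              then show False
                using E_norm[of y] Kr[OF \<open>y \<in> K\<close>] \<open>1 < c\<close> W(1) by auto
            qed
          qed
          then show False using freq by blast
        qed
        ultimately have "x \<in> X"
          using \<open>x \<notin> P\<close> by (simp add: X_def)
        have "c \<le> cmod (E x)"
        proof (rule ccontr)
          assume "\<not> c \<le> cmod (E x)"
          moreover have "filterlim E (nhds (E x)) (nhds x)"
            using holomorphic_on_imp_continuous_on[OF Eh] open_X \<open>x \<in> X\<close>
            by (simp add: continuous_on_eq_continuous_at isCont_def tendsto_at_iff_tendsto_nhds)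
          ultimately have "eventually (\<lambda>y. cmod (E y) < c) (nhds x)"
            by (intro order_tendstoD(2)[OF tendsto_norm]) auto
          then have "eventually (\<lambda>y. y \<notin> K) (nhds x)"
            by (rule eventually_mono) (use Kr in force)
          then show False using freq by blast
        qed
        moreover have "x \<in> W"
        proof (rule ccontr)
          assume "x \<notin> W"
          moreover have "x \<in> closure W"
            using x closure_mono[of K W] by (auto simp: K_def)
          ultimately have "x \<in> frontier W"
            using W(2) by (simp add: frontier_def interior_open)
          then have "ln c \<le> 0"
            using c_le[OF \<open>x \<in> X\<close> \<open>c \<le> cmod (E x)\<close>] front[OF \<open>x \<in> X\<close>] by simp
          then show False
            using \<open>1 < c\<close> by simp
        qed
        ultimately show ?thesis
          by (simp add: K_def)
      qed
      then have "closure K \<subseteq> K" by blast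
      then show ?thesis by (simp add: closure_subset_eq)
    qed
    ultimately have "compact K"
      by (simp add: compact_eq_bounded_closed)
    then have "cmod (E z) < c"
      using W \<open>z \<in> W\<close> unfolding K_def
      by (intro compact_superlevel_empty[OF W(2) holomorphic_on_subset[OF Eh W(1)]])
    then show ?thesis
      using E_norm[of z] W(1) \<open>z \<in> W\<close> \<open>1 < c\<close> by (metis exp_le_cancel_iff exp_ln less_imp_le less_trans subsetD zero_less_one)
  qed
  show ?thesis
  proof (rule ccontr)
    assume "\<not> Re (h z) \<le> 0"
    then have pos: "0 < Re (h z)" by simp
    have B: "B z \<le> 0"
      using B_le W(1) \<open>z \<in> W\<close> by blast
    \<comment> \<open>At the fixed point \<open>z\<close> the barrier now costs at most a quarter of
      \<open>Re (h z)\<close>, whereas the threshold \<open>c\<close> used below corresponds to one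
      half of it.\<close>
    define \<epsilon> where "\<epsilon> = Re (h z) / (4 * (1 - B z))"
    have "0 < \<epsilon>"
      using pos B by (simp add: \<epsilon>_def)
    have "\<epsilon> * (- B z) \<le> \<epsilon> * (1 - B z)"
      using \<open>0 < \<epsilon>\<close> by (intro mult_left_mono) auto
    also have "\<dots> = Re (h z) / 4"
      using B by (simp add: \<epsilon>_def divide_simps)
    finally have "Re (h z) * (3/4) \<le> Re (h z) + \<epsilon> * B z"
      by simp
    also have "\<dots> \<le> ln (exp (Re (h z) / 2))"
      using pos by (intro step \<open>0 < \<epsilon>\<close>) auto
    finally show False
      using pos by simp
  qed
qed

end

lemma filterlim_cnj_at_infinity: "filterlim cnj at_infinity at_infinity"
  by (rule filterlim_norm_at_top_imp_at_infinity) (simp add: filterlim_norm_at_top)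

section \<open>Comparison of competitors with \<open>r\<close>\<close>

context real_pole_function
begin

lemma frontier_U_Im: "z \<in> frontier U \<Longrightarrow> z \<in> X \<Longrightarrow> Im z = 0"
proof -
  assume "z \<in> frontier U" "z \<in> X"
  then have "z \<in> closure U" "z \<notin> U"
    using open_U by (auto simp: frontier_def interior_open)
  moreover have "closure U \<subseteq> {z. 0 \<le> Im z}"
    by (intro closure_minimal closed_halfspace_Im_ge) (auto simp: U_def)
  ultimately show ?thesis
    using \<open>z \<in> X\<close> by (auto simp: U_def)
qed

lemma eq_on_X_if_eq_near_infinity:
  assumes "connected X" "f holomorphic_on X" "g holomorphic_on X"
    and "\<And>z. R < cmod z \<Longrightarrow> f z = g z" "\<And>z. R < cmod z \<Longrightarrow> z \<in> X" "z \<in> X"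
  shows "f z = g z"
proof (rule analytic_continuation_open[of "{z. R < cmod z}" X f g])
  show "open {z. R < cmod z}"
    by (intro open_Collect_less continuous_intros)
  have "R < cmod (of_real (\<bar>R\<bar> + 1))"
    by (subst norm_of_real) simp
  then show "{z. R < cmod z} \<noteq> {}"
    by blast
qed (use assms open_X in auto)

text \<open>The sum of \<open>L(g)\<close> and its reflection is real on the real axis, so the
  comparison can be made on \<open>U\<close> alone. There the sign of \<open>Im r\<close> gives
  \<open>Im L(r) = - |Im L(r)|\<close>, and the trivial strip bound on \<open>L(g)\<close> becomes
  exactly the estimate that the boundary maximum principle asks for.\<close>

lemma symmetrized_competitor:
  assumes "connected X" and U_le: "\<And>z. z \<in> U \<Longrightarrow> Im (r z) \<le> 0"
    and A: "((\<lambda>z. z * r z) \<longlongrightarrow> A) at_infinity"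
    and g: "g holomorphic_on X" "\<And>z. z \<in> X \<Longrightarrow> cmod (g z) < 1" "(g \<longlongrightarrow> 0) at_infinity"
    and c: "((\<lambda>z. z * g z) \<longlongrightarrow> c) at_infinity"
  shows "Re c < Re A \<or> Re c = Re A \<and>
    (\<forall>z\<in>X. cayley_log (g z) + cnj (cayley_log (g (cnj z))) = 2 * cayley_log (r z))"
proof -
  define L where "L = (\<lambda>z. cayley_log (g z))"
  define F where "F = (\<lambda>z. L z + cnj (L (cnj z)) - 2 * cayley_log (r z))"
  have L: "L holomorphic_on X"
    unfolding L_def by (intro holomorphic_intros g)
  have "(cnj \<circ> L \<circ> cnj) holomorphic_on X"
  proof -
    have "cnj ` X = X"
    proof
      show "X \<subseteq> cnj ` X"
        using cnj_X_iff by (intro subsetI image_eqI[of _ cnj "cnj _"]) simp_all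
    qed (auto simp: cnj_X_iff)
    then show ?thesis
      using L by (simp add: holomorphic_on_compose_cnj_cnj open_X)
  qed
  then have F: "F holomorphic_on X"
    unfolding F_def by (intro holomorphic_intros L holomorphic_cayley_log_r) (simp add: o_def)
  have L_inf: "(L \<longlongrightarrow> 0) at_infinity"
    unfolding L_def by (rule tendsto_cayley_log_0[OF g(3)])
  have "((\<lambda>z. cnj (L (cnj z))) \<longlongrightarrow> cnj 0) at_infinity"
    by (intro tendsto_cnj filterlim_compose[OF L_inf filterlim_cnj_at_infinity])
  from tendsto_diff[OF tendsto_add[OF L_inf this] tendsto_mult_left[OF cayley_log_r_infinity, of 2]]
  have F_inf: "(F \<longlongrightarrow> 0) at_infinity"
    unfolding F_def by simp
  have Lc: "((\<lambda>z. z * L z) \<longlongrightarrow> 2 * c) at_infinity"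
    unfolding L_def by (rule cayley_log_at_infinity[OF g(3) c])
  have Lc': "((\<lambda>z. cnj (cnj z * L (cnj z))) \<longlongrightarrow> cnj (2 * c)) at_infinity"
    by (intro tendsto_cnj filterlim_compose[OF Lc filterlim_cnj_at_infinity])
  have "((\<lambda>z. z * L z + cnj (cnj z * L (cnj z)) - 2 * (z * cayley_log (r z))) \<longlongrightarrow>
      2 * c + cnj (2 * c) - 2 * (2 * A)) at_infinity"
    by (intro tendsto_intros Lc Lc' cayley_log_at_infinity r_infinity A)
  then have Fc: "((\<lambda>z. z * F z) \<longlongrightarrow> 2 * c + cnj (2 * c) - 2 * (2 * A)) at_infinity"
    by (simp add: F_def algebra_simps)
  have Im_F: "0 \<le> Im (F z)" if "z \<in> U" for z
  proof -
    \<comment> \<open>Two strip functions, each with imaginary part above \<open>- pi / 2\<close>,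
      account for \<open>\<kappa> = 2\<close>.\<close>
    have "Re (\<i> * F z) \<le> 0"
    proof (rule boundary_maximum_principle[where h = "\<lambda>z. \<i> * F z" and W = U and \<kappa> = 2])
      show "(\<lambda>z. \<i> * F z) holomorphic_on X"
        by (intro holomorphic_intros F)
      show "((\<lambda>z. Re (\<i> * F z)) \<longlongrightarrow> 0) at_infinity"
        using tendsto_Re[OF tendsto_mult_left[OF F_inf, of \<i>]] by simp
    next
      fix z assume z: "z \<in> U"
      then have zX: "z \<in> X" "cnj z \<in> X"
        by (auto simp: U_def cnj_X_iff)
      have "\<bar>Im (L z)\<bar> < pi / 2" "\<bar>Im (L (cnj z))\<bar> < pi / 2"
        unfolding L_def by (intro Im_cayley_log_less g(2) zX)+
      moreover have "Im (cayley_log (r z)) \<le> 0"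
        using U_le[OF z] Im_cayley_log_nonpos_iff[OF X_norm_less[OF zX(1)]] by simp
      ultimately show "Re (\<i> * F z) \<le> 2 * (pi / 2 - \<bar>Im (cayley_log (r z))\<bar>)"
        by (simp add: F_def)
    next
      fix z assume "z \<in> X" "z \<in> frontier U"
      then have "Im z = 0" "Im (cayley_log (r z)) = 0"
        using frontier_U_Im Im_cayley_log_r_real by auto
      moreover from this have "cnj z = z"
        by (simp add: complex_eq_iff)
      ultimately show "Re (\<i> * F z) \<le> 0"
        by (simp add: F_def)
    qed (use that open_U in \<open>auto simp: U_def\<close>)
    then show ?thesis by simp
  qed
  obtain R where R: "0 < R" "\<And>z. R < cmod z \<Longrightarrow> z \<in> X"
    using exists_radius by blast
  have "(\<forall>z. R < cmod z \<longrightarrow> F z = 0) \<or> Re (2 * c + cnj (2 * c) - 2 * (2 * A)) < 0"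
    by (rule half_plane_boundary_derivative_at_infinity[OF R(1) holomorphic_on_subset[OF F] F_inf _ Fc])
       (use R(2) Im_F in \<open>auto simp: U_def\<close>)
  then show ?thesis
  proof
    assume F0: "\<forall>z. R < cmod z \<longrightarrow> F z = 0"
    have "F z = 0" if "z \<in> X" for z
      by (rule eq_on_X_if_eq_near_infinity[OF assms(1) F _ _ R(2) that]) (use F0 in auto)
    moreover have "eventually (\<lambda>z. z * F z = 0) at_infinity"
      using F0 R(1) by (intro eventually_at_infinityI[of "R + 1"]) auto
    then have "((\<lambda>z. z * F z) \<longlongrightarrow> 0) at_infinity"
      by (rule tendsto_eventually)
    then have "2 * c + cnj (2 * c) - 2 * (2 * A) = 0"
      using Fc tendsto_unique[OF trivial_limit_at_infinity] by blast
    then have "Re c = Re A"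
      by (simp add: complex_eq_iff)
    ultimately show ?thesis
      by (simp add: F_def L_def)
  qed simp
qed

text \<open>Two numbers in the interval (- pi / 2, pi / 2) with mean \<open>m\<close> differ from
  \<open>m\<close> by at most \<open>pi / 2 - |m|\<close>. Applied to the imaginary parts of
  \<open>L(g)\<close> and its reflection, this bounds \<open>Im D\<close> from both sides by a
  quantity that vanishes where |r| = 1. Hence \<open>Im D\<close> is 0 and \<open>D\<close> is
  constant, with limit 0 at infinity.\<close>

lemma competitor_eq_if_symmetrization_eq:
  assumes "connected X"
    and g: "g holomorphic_on X" "\<And>z. z \<in> X \<Longrightarrow> cmod (g z) < 1" "(g \<longlongrightarrow> 0) at_infinity"
    and eq: "\<And>z. z \<in> X \<Longrightarrow> cayley_log (g z) + cnj (cayley_log (g (cnj z))) = 2 * cayley_log (r z)"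
    and "z \<in> X"
  shows "g z = r z"
proof -
  define L where "L = (\<lambda>z. cayley_log (g z))"
  define D where "D = (\<lambda>z. L z - cayley_log (r z))"
  have L: "L holomorphic_on X"
    unfolding L_def by (intro holomorphic_intros g)
  have D: "D holomorphic_on X"
    unfolding D_def by (intro holomorphic_intros L holomorphic_cayley_log_r)
  have D_inf: "(D \<longlongrightarrow> 0) at_infinity"
    using tendsto_diff[OF tendsto_cayley_log_0[OF g(3)] cayley_log_r_infinity]
    unfolding D_def L_def by simp
  have key: "\<bar>Im (D z)\<bar> \<le> pi / 2 - \<bar>Im (cayley_log (r z))\<bar>" if "z \<in> X" for z
  proof -
    have L_less: "\<bar>Im (L y)\<bar> < pi / 2" if "y \<in> X" for y
      unfolding L_def by (rule Im_cayley_log_less[OF g(2)[OF that]])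
    have "\<bar>Im (L z)\<bar> < pi / 2" "\<bar>Im (L (cnj z))\<bar> < pi / 2"
      using L_less that cnj_X_iff by blast+
    moreover have "Im (L z) - Im (L (cnj z)) = 2 * Im (cayley_log (r z))"
      using arg_cong[OF eq[OF that], of Im] by (simp add: L_def)
    ultimately show ?thesis
      unfolding D_def minus_complex.sel by linarith
  qed
  \<comment> \<open>With \<open>W = X\<close> no frontier point lies in \<open>X\<close>, so only
    the boundary estimate and the limit at infinity matter.\<close>
  have Im_D: "Re (s * D z) \<le> 0" if "s = \<i> \<or> s = - \<i>" "z \<in> X" for s z
  proof (rule boundary_maximum_principle[where h = "\<lambda>z. s * D z" and W = X and \<kappa> = 1])
    show "(\<lambda>z. s * D z) holomorphic_on X"
      by (intro holomorphic_intros D)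
    show "((\<lambda>z. Re (s * D z)) \<longlongrightarrow> 0) at_infinity"
      using tendsto_Re[OF tendsto_mult_left[OF D_inf, of s]] by simp
    fix z assume "z \<in> X"
    then show "Re (s * D z) \<le> 1 * (pi / 2 - \<bar>Im (cayley_log (r z))\<bar>)"
      using that(1) key[of z] by auto
  qed (use that open_X in \<open>auto simp: frontier_def interior_open\<close>)
  have Im_D0: "Im (D z) = 0" if "z \<in> X" for z
    using Im_D[of \<i> z] Im_D[of "-\<i>" z] that by simp
  have "D constant_on X"
  proof (rule ccontr)
    assume "\<not> D constant_on X"
    then have "open (D ` X)"
      using open_mapping_thm[OF D open_X assms(1) open_X order_refl] by blast
    then obtain e where e: "0 < e" "ball (D z) e \<subseteq> D ` X"
      using \<open>z \<in> X\<close> open_contains_ball by blast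
    have "D z + \<i> * of_real (e / 2) \<in> ball (D z) e"
      using e(1) by (simp add: dist_norm norm_mult)
    then obtain y where "y \<in> X" "D y = D z + \<i> * of_real (e / 2)"
      using e(2) by (metis imageE subsetD)
    then show False
      using Im_D0[of y] Im_D0[OF \<open>z \<in> X\<close>] e(1) by simp
  qed
  then obtain k where k: "\<And>z. z \<in> X \<Longrightarrow> D z = k"
    by (auto simp: constant_on_def)
  have "eventually (\<lambda>z. D z = k) at_infinity"
  proof -
    obtain R where "0 < R" "\<And>z. R < cmod z \<Longrightarrow> z \<in> X"
      using exists_radius by blast
    then show ?thesis
      using k by (intro eventually_at_infinityI[of "R + 1"]) auto
  qed
  then have "k = 0"
    using D_inf tendsto_unique[OF trivial_limit_at_infinity tendsto_eventually] by blast
  then have "cayley_log (g z) = cayley_log (r z)"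
    using k[OF \<open>z \<in> X\<close>] by (simp add: D_def L_def)
  then show ?thesis
    by (rule cayley_log_inject[OF g(2)[OF \<open>z \<in> X\<close>] X_norm_less[OF \<open>z \<in> X\<close>]])
qed

end

section \<open>Harmonic minorants and reflection\<close>

text \<open>The real part is the Poisson integral of \<open>s\<close>, normalized by the
  parametrization over [0, 1]; the imaginary part is the harmonic conjugate vanishing at 0.
  Holomorphic families obtained in this way are accessible to Montel's theorem.\<close>

definition schwarz_integral :: "(complex \<Rightarrow> real) \<Rightarrow> complex \<Rightarrow> complex" where
  "schwarz_integral s z = integral {0..1}
     (\<lambda>t. of_real (s (cis (2 * pi * t))) * ((cis (2 * pi * t) + z) / (cis (2 * pi * t) - z)))"

lemma cis_neq_if_norm_less: "cmod z < 1 \<Longrightarrow> cis t - z \<noteq> 0"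
  by auto

lemma continuous_on_cis_circle:
  assumes "continuous_on (sphere 0 1) s"
  shows "continuous_on A (\<lambda>t. s (cis (2 * pi * t)))"
  by (rule continuous_on_compose2[OF assms]) (auto intro!: continuous_intros)

lemma schwarz_integrand_continuous:
  assumes "continuous_on (sphere 0 1) s" "cmod z < 1"
  shows "continuous_on A (\<lambda>t. of_real (s (cis (2 * pi * t))) *
           ((cis (2 * pi * t) + z) / (cis (2 * pi * t) - z)))"
  using assms(2)
  by (auto intro!: continuous_intros continuous_on_cis_circle[OF assms(1)] simp: cis_neq_if_norm_less)

lemma holomorphic_schwarz_integral:
  assumes "continuous_on (sphere 0 1) s"
  shows "schwarz_integral s holomorphic_on ball 0 1"
proof -
  have "(\<lambda>z. integral (cbox 0 1)
     (\<lambda>t. of_real (s (cis (2 * pi * t))) * ((cis (2 * pi * t) + z) / (cis (2 * pi * t) - z))))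
     holomorphic_on ball 0 1"
  proof (rule leibniz_rule_holomorphic)
    fix z :: complex and t :: real
    assume "z \<in> ball 0 1"
    then have "cis (2 * pi * t) - z \<noteq> 0"
      by auto
    then show "((\<lambda>z. of_real (s (cis (2 * pi * t))) * ((cis (2 * pi * t) + z) / (cis (2 * pi * t) - z)))
        has_field_derivative
        of_real (s (cis (2 * pi * t))) * (2 * cis (2 * pi * t) / (cis (2 * pi * t) - z)\<^sup>2)) (at z within ball 0 1)"
      by (auto intro!: derivative_eq_intros simp: power2_eq_square) (simp add: algebra_simps)
  next
    fix z :: complex
    assume "z \<in> ball 0 1"
    then show "(\<lambda>t. of_real (s (cis (2 * pi * t))) * ((cis (2 * pi * t) + z) / (cis (2 * pi * t) - z)))
        integrable_on cbox 0 1"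
      by (intro integrable_continuous schwarz_integrand_continuous assms) auto
  next
    have "continuous_on (ball 0 1 \<times> cbox 0 1) (\<lambda>x. s (cis (2 * pi * snd x)))"
      by (rule continuous_on_compose2[OF assms]) (auto intro!: continuous_intros)
    then show "continuous_on (ball 0 1 \<times> cbox 0 1)
       (\<lambda>(z, t). of_real (s (cis (2 * pi * t))) * (2 * cis (2 * pi * t) / (cis (2 * pi * t) - z)\<^sup>2))"
      unfolding case_prod_beta
      by (intro continuous_intros) auto
  qed auto
  then show ?thesis
    by (simp add: schwarz_integral_def [abs_def])
qed

lemma cmod_schwarz_kernel_le:
  assumes "cmod z < 1"
  shows "cmod ((cis t + z) / (cis t - z)) \<le> (1 + cmod z) / (1 - cmod z)"
proof -
  have "cmod (cis t + z) \<le> 1 + cmod z"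
    using norm_triangle_ineq[of "cis t" z] by simp
  moreover have "1 - cmod z \<le> cmod (cis t - z)"
    using norm_triangle_ineq2[of "cis t" z] by simp
  ultimately show ?thesis
    unfolding norm_divide using assms by (intro frac_le) auto
qed

text \<open>The bound depends on \<open>s\<close> only through \<open>C\<close>, which gives local
  boundedness for a whole family of boundary functions.\<close>

lemma cmod_schwarz_integral_le:
  assumes "continuous_on (sphere 0 1) s" "\<And>w. w \<in> sphere 0 1 \<Longrightarrow> \<bar>s w\<bar> \<le> C" "cmod z < 1"
  shows "cmod (schwarz_integral s z) \<le> C * ((1 + cmod z) / (1 - cmod z))"
proof -
  have "cmod (schwarz_integral s z) \<le> C * ((1 + cmod z) / (1 - cmod z)) * (1 - 0)"
    unfolding schwarz_integral_def
  proof (rule integral_bound[OF _ schwarz_integrand_continuous[OF assms(1,3)]])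
    fix t :: real
    show "cmod (of_real (s (cis (2 * pi * t))) * ((cis (2 * pi * t) + z) / (cis (2 * pi * t) - z)))
        \<le> C * ((1 + cmod z) / (1 - cmod z))"
      unfolding norm_mult using assms(2)[of "cis (2 * pi * t)"]
      by (intro mult_mono cmod_schwarz_kernel_le assms(3)) auto
  qed auto
  then show ?thesis by simp
qed

text \<open>The right side is the Poisson kernel; its positivity makes the real part of the integral
  monotone in \<open>s\<close>.\<close>

lemma schwarz_kernel_Re:
  assumes "cmod z < 1"
  shows "Re ((cis t + z) / (cis t - z)) = (1 - (cmod z)\<^sup>2) / (cmod (cis t - z))\<^sup>2"
proof -
  have "1 = (Re (cis t))\<^sup>2 + (Im (cis t))\<^sup>2"
    by simp
  then show ?thesis
    unfolding Re_divide cmod_power2 by (simp add: power2_eq_square algebra_simps)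
qed

lemma Re_schwarz_integral:
  assumes "continuous_on (sphere 0 1) s" "cmod z < 1"
  shows "((\<lambda>t. s (cis (2 * pi * t)) * Re ((cis (2 * pi * t) + z) / (cis (2 * pi * t) - z)))
    has_integral Re (schwarz_integral s z)) {0..1}"
proof -
  have eq: "Re (of_real a * w) = a * Re w" for a w
    by simp
  have "((\<lambda>t. of_real (s (cis (2 * pi * t))) * ((cis (2 * pi * t) + z) / (cis (2 * pi * t) - z)))
    has_integral schwarz_integral s z) {0..1}"
    unfolding schwarz_integral_def
    by (intro integrable_integral integrable_continuous_real schwarz_integrand_continuous assms)
  from has_integral_linear[OF this bounded_linear_Re] show ?thesis
    by (simp only: o_def eq)
qed

lemma Re_schwarz_integral_mono:
  assumes "continuous_on (sphere 0 1) s" "continuous_on (sphere 0 1) s'"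
    and "\<And>w. w \<in> sphere 0 1 \<Longrightarrow> s w \<le> s' w" "cmod z < 1"
  shows "Re (schwarz_integral s z) \<le> Re (schwarz_integral s' z)"
proof (rule has_integral_le[OF Re_schwarz_integral Re_schwarz_integral])
  fix t :: real
  have "(cmod z)\<^sup>2 \<le> 1"
    using assms(4) by (simp add: power_le_one)
  then have "0 \<le> Re ((cis (2 * pi * t) + z) / (cis (2 * pi * t) - z))"
    unfolding schwarz_kernel_Re[OF assms(4)] by simp
  then show "s (cis (2 * pi * t)) * Re ((cis (2 * pi * t) + z) / (cis (2 * pi * t) - z))
      \<le> s' (cis (2 * pi * t)) * Re ((cis (2 * pi * t) + z) / (cis (2 * pi * t) - z))"
    by (intro mult_right_mono assms(3)) auto
qed (use assms in auto)

text \<open>Cauchy's formula for \<open>z\<close> is combined with Cauchy's theorem for a kernel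
  whose pole is the reflected point \<open>1 / cnj z\<close>. On the circle the two kernels add up
  to the Poisson kernel, which is real, so taking real parts is harmless.\<close>

lemma poisson_formula:
  assumes h: "h holomorphic_on ball 0 R" and "1 < R" and z: "cmod z < 1"
  shows "Re (schwarz_integral (\<lambda>w. Re (h w)) z) = Re (h z)"
proof -
  define K where "K = (\<lambda>\<zeta>. h \<zeta> / (\<zeta> - z) + h \<zeta> * (cnj z / (1 - cnj z * \<zeta>)))"
  have "((\<lambda>\<zeta>. h \<zeta> / (\<zeta> - z)) has_contour_integral (2 * of_real pi * \<i> * h z)) (circlepath 0 1)"
    by (rule Cauchy_integral_circlepath_simple[OF holomorphic_on_subset[OF h]])
       (use z \<open>1 < R\<close> in auto)
  moreover have "((\<lambda>\<zeta>. h \<zeta> * (cnj z / (1 - cnj z * \<zeta>))) has_contour_integral 0) (circlepath 0 1)"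
  proof -
    \<comment> \<open>The reflected pole has modulus \<open>1 / cmod z > 1\<close> and disappears
      for \<open>z = 0\<close>; \<open>\<rho>\<close> stays within both this radius and
      \<open>R\<close>.\<close>
    define \<rho> where "\<rho> = (if z = 0 then R else min R (1 / cmod z))"
    have \<rho>: "1 < \<rho>" "\<rho> \<le> R"
      using z \<open>1 < R\<close> by (auto simp: \<rho>_def)
    have "1 - cnj z * \<zeta> \<noteq> 0" if "\<zeta> \<in> ball 0 \<rho>" for \<zeta>
    proof
      assume "1 - cnj z * \<zeta> = 0"
      then have "cmod (cnj z * \<zeta>) = 1"
        by (metis eq_iff_diff_eq_0 norm_one)
      then show False
        using that by (cases "z = 0") (auto simp: \<rho>_def norm_mult field_simps)
    qed
    then show ?thesis
      by (intro Cauchy_theorem_disc_simple[of _ 0 \<rho>] holomorphic_intros holomorphic_on_subset[OF h])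
         (use \<rho> in auto)
  qed
  ultimately have "(K has_contour_integral (2 * of_real pi * \<i> * h z + 0)) (circlepath 0 1)"
    unfolding K_def by (rule has_contour_integral_add)
  then have K: "((\<lambda>t. K (circlepath 0 1 t) * vector_derivative (circlepath 0 1) (at t within {0..1}))
      has_integral (2 * of_real pi * \<i> * h z)) {0..1}"
    by (simp add: has_contour_integral_def)
  have "((\<lambda>t. K (cis (2 * pi * t)) * (2 * of_real pi * \<i> * cis (2 * pi * t)))
      has_integral (2 * of_real pi * \<i> * h z)) {0..1}"
    by (rule has_integral_eq[OF _ K])
       (simp add: vector_derivative_circlepath01, simp add: circlepath cis_conv_exp mult_ac)
  moreover have "(\<lambda>t. K (cis (2 * pi * t)) * (2 * of_real pi * \<i> * cis (2 * pi * t))) =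
     (\<lambda>t. (2 * of_real pi * \<i>) * (h (cis (2 * pi * t)) *
        of_real (Re ((cis (2 * pi * t) + z) / (cis (2 * pi * t) - z)))))"
  proof
    fix t :: real
    define e where "e = cis (2 * pi * t)"
    have ne: "e - z \<noteq> 0"
      using z by (auto simp: e_def)
    then have ne': "cnj e - cnj z \<noteq> 0"
      by simp
    have ee: "e * cnj e = 1"
      by (simp add: e_def complex_norm_square[symmetric])
    have "cnj z / (1 - cnj z * e) * e = cnj z / (cnj e - cnj z)"
    proof -
      have "1 - cnj z * e = e * (cnj e - cnj z)" "e \<noteq> 0"
        using ee by (auto simp: algebra_simps e_def)
      then show ?thesis by simp
    qed
    moreover have "e / (e - z) + cnj z / (cnj e - cnj z) = of_real (Re ((e + z) / (e - z)))"
    proof -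
      have "e / (e - z) + cnj z / (cnj e - cnj z) = (1 - z * cnj z) / ((e - z) * cnj (e - z))"
        using ne ne' ee by (simp add: divide_simps) (simp add: algebra_simps)
      also have "\<dots> = of_real ((1 - (cmod z)\<^sup>2) / (cmod (e - z))\<^sup>2)"
        by (simp only: complex_norm_square[symmetric] of_real_divide of_real_diff of_real_1)
      finally show ?thesis
        unfolding e_def schwarz_kernel_Re[OF z] .
    qed
    moreover have "K e * (2 * of_real pi * \<i> * e) =
      (2 * of_real pi * \<i>) * (h e * (e / (e - z) + cnj z / (1 - cnj z * e) * e))"
      by (simp add: K_def algebra_simps)
    ultimately show "K (cis (2 * pi * t)) * (2 * of_real pi * \<i> * cis (2 * pi * t)) =
      (2 * of_real pi * \<i>) * (h (cis (2 * pi * t)) *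
        of_real (Re ((cis (2 * pi * t) + z) / (cis (2 * pi * t) - z))))"
      unfolding e_def by simp
  qed
  ultimately have "((\<lambda>t. (2 * of_real pi * \<i>) * (h (cis (2 * pi * t)) *
        of_real (Re ((cis (2 * pi * t) + z) / (cis (2 * pi * t) - z)))))
      has_integral (2 * of_real pi * \<i> * h z)) {0..1}"
    by metis
  then have "((\<lambda>t. h (cis (2 * pi * t)) * of_real (Re ((cis (2 * pi * t) + z) / (cis (2 * pi * t) - z))))
      has_integral (2 * of_real pi * \<i> * h z) / (2 * of_real pi * \<i>)) {0..1}"
    by (subst (asm) has_integral_mult_right_iff) auto
  then have I: "((\<lambda>t. h (cis (2 * pi * t)) * of_real (Re ((cis (2 * pi * t) + z) / (cis (2 * pi * t) - z))))
      has_integral h z) {0..1}"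
    by simp
  have eq: "Re (w * of_real a) = Re w * a" for a w
    by simp
  have "((\<lambda>t. Re (h (cis (2 * pi * t))) * Re ((cis (2 * pi * t) + z) / (cis (2 * pi * t) - z)))
      has_integral Re (h z)) {0..1}"
    using has_integral_linear[OF I bounded_linear_Re] by (simp only: o_def eq)
  moreover have "continuous_on (sphere 0 1) (\<lambda>w. Re (h w))"
    by (intro continuous_intros holomorphic_on_imp_continuous_on holomorphic_on_subset[OF h])
       (use \<open>1 < R\<close> in auto)
  ultimately show ?thesis
    using Re_schwarz_integral[of "\<lambda>w. Re (h w)" z] z has_integral_unique by blast
qed

text \<open>Poisson integrals of \<open>min 0 (Re b)\<close> over the circles of radius \<open>\<rho> < 1\<close> lie below \<open>0\<close> and
  \<open>Re b\<close> and above every harmonic minorant, because the Poisson kernel is positive and reproduces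
  harmonic functions; no boundary behaviour is involved.\<close>

lemma greatest_harmonic_minorant_disc:
  assumes b: "b holomorphic_on ball 0 1" and C: "\<And>z. z \<in> ball 0 1 \<Longrightarrow> \<bar>Re (b z)\<bar> \<le> C"
  shows "\<exists>f. f holomorphic_on ball 0 1 \<and> (\<forall>z\<in>ball 0 1. Re (f z) \<le> 0 \<and> Re (f z) \<le> Re (b z)) \<and>
    (\<forall>N. N holomorphic_on ball 0 1 \<longrightarrow> (\<forall>z\<in>ball 0 1. Re (N z) \<le> 0 \<and> Re (N z) \<le> Re (b z)) \<longrightarrow>
       (\<forall>z\<in>ball 0 1. Re (N z) \<le> Re (f z)))"
proof -
  \<comment> \<open>The shift starts the radii at 1/2: radius 0 would spoil the scaled discs of
    radius \<open>1 / \<rho> n\<close>.\<close>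
  define \<rho> where "\<rho> = (\<lambda>n. real (Suc n) / real (Suc (Suc n)))"
  have \<rho>: "0 < \<rho> n" "\<rho> n < 1" for n
    by (auto simp: \<rho>_def)
  have \<rho>_lim: "\<rho> \<longlonglongrightarrow> 1"
    unfolding \<rho>_def by (rule LIMSEQ_Suc[OF LIMSEQ_n_over_Suc_n])
  have scaled: "(\<lambda>w. h (of_real (\<rho> n) * w)) holomorphic_on ball 0 (1 / \<rho> n)"
    if "h holomorphic_on ball 0 1" for h :: "complex \<Rightarrow> complex" and n
    by (rule holomorphic_on_compose_gen[OF _ that, unfolded o_def])
       (use \<rho>[of n] in \<open>auto intro!: holomorphic_intros simp: norm_mult field_simps\<close>)
  have radius: "1 < 1 / \<rho> n" for n
    using \<rho>[of n] by simp
  have cont: "continuous_on (sphere 0 1) (\<lambda>w. Re (h (of_real (\<rho> n) * w)))"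
    if "h holomorphic_on ball 0 1" for h :: "complex \<Rightarrow> complex" and n
    by (intro continuous_intros holomorphic_on_imp_continuous_on holomorphic_on_subset[OF scaled[OF that, of n]])
       (use radius[of n] in auto)
  have poisson: "Re (schwarz_integral (\<lambda>w. Re (h (of_real (\<rho> n) * w))) z) = Re (h (of_real (\<rho> n) * z))"
    if "h holomorphic_on ball 0 1" "cmod z < 1" for h :: "complex \<Rightarrow> complex" and n z
    by (rule poisson_formula[OF scaled[OF that(1)] radius that(2)])
  define s where "s = (\<lambda>n w. min 0 (Re (b (of_real (\<rho> n) * w))))"
  define F where "F = (\<lambda>n. schwarz_integral (s n))"
  have s_cont: "continuous_on (sphere 0 1) (s n)" for n
    unfolding s_def by (intro continuous_intros cont b)
  have in_ball: "of_real (\<rho> n) * w \<in> ball 0 1" if "cmod w \<le> 1" for n and w :: complex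
  proof -
    have "\<rho> n * cmod w \<le> \<rho> n * 1"
      using \<rho>[of n] that by (intro mult_left_mono) auto
    then have "\<rho> n * cmod w < 1"
      using \<rho>[of n] by linarith
    then show ?thesis
      using \<rho>[of n] by (simp add: norm_mult)
  qed
  have s_bound: "\<bar>s n w\<bar> \<le> C" if "w \<in> sphere 0 1" for n w
    using C[OF in_ball[of w n]] that unfolding s_def by auto
  have F_bound: "cmod (F n z) \<le> C * ((1 + cmod z) / (1 - cmod z))" if "cmod z < 1" for n z
    unfolding F_def by (rule cmod_schwarz_integral_le[OF s_cont s_bound that])
  have F_le: "Re (F n z) \<le> 0" "Re (F n z) \<le> Re (b (of_real (\<rho> n) * z))" if "cmod z < 1" for n z
  proof -
    have "Re (F n z) \<le> Re (schwarz_integral (\<lambda>w. Re ((\<lambda>_. 0) (of_real (\<rho> n) * w))) z)"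
      unfolding F_def by (intro Re_schwarz_integral_mono s_cont cont that) (auto simp: s_def)
    then show "Re (F n z) \<le> 0"
      by (subst (asm) poisson) (auto simp: that)
    have "Re (F n z) \<le> Re (schwarz_integral (\<lambda>w. Re (b (of_real (\<rho> n) * w))) z)"
      unfolding F_def by (intro Re_schwarz_integral_mono s_cont cont b that) (auto simp: s_def)
    then show "Re (F n z) \<le> Re (b (of_real (\<rho> n) * z))"
      by (simp add: poisson[OF b that])
  qed
  have le_F: "Re (N (of_real (\<rho> n) * z)) \<le> Re (F n z)"
    if "N holomorphic_on ball 0 1" "\<forall>z\<in>ball 0 1. Re (N z) \<le> 0 \<and> Re (N z) \<le> Re (b z)" "cmod z < 1" for N n z
  proof -
    have "Re (schwarz_integral (\<lambda>w. Re (N (of_real (\<rho> n) * w))) z) \<le> Re (F n z)"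
      unfolding F_def
    proof (intro Re_schwarz_integral_mono s_cont cont that)
      fix w :: complex assume "w \<in> sphere 0 1"
      then show "Re (N (of_real (\<rho> n) * w)) \<le> s n w"
        using that(2) in_ball[of w n] by (simp add: s_def)
    qed
    then show ?thesis
      by (simp add: poisson[OF that(1,3)])
  qed
  have F_bounded: "\<exists>B. \<forall>h\<in>range F. \<forall>z\<in>K. cmod (h z) \<le> B" if K: "compact K" "K \<subseteq> ball 0 1" for K
  proof -
    have "continuous_on K (\<lambda>z. C * ((1 + cmod z) / (1 - cmod z)))"
      using K(2) by (intro continuous_intros) auto
    then have "bounded ((\<lambda>z. C * ((1 + cmod z) / (1 - cmod z))) ` K)"
      using K(1) compact_continuous_image compact_imp_bounded by blast
    then obtain B where "\<And>z. z \<in> K \<Longrightarrow> \<bar>C * ((1 + cmod z) / (1 - cmod z))\<bar> \<le> B"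
      by (auto simp: bounded_iff)
    then have "cmod (F n z) \<le> B" if "z \<in> K" for n z
      using F_bound[of z n] K(2) that by (meson abs_ge_self mem_ball_0 order_trans subsetD)
    then show ?thesis by blast
  qed
  \<comment> \<open>Convergence of a subsequence suffices, since the upper bounds and the comparison
    with each minorant hold for every \<open>n\<close> and pass to the limit.\<close>
  obtain f k where f: "f holomorphic_on ball 0 1" and k: "strict_mono (k :: nat \<Rightarrow> nat)"
    and lim: "\<And>z. z \<in> ball 0 1 \<Longrightarrow> (\<lambda>n. F (k n) z) \<longlonglongrightarrow> f z"
    by (rule Montel[OF open_ball _ F_bounded order_refl])
       (auto simp: F_def holomorphic_schwarz_integral s_cont)
  have scale_lim: "(\<lambda>n. Re (h (of_real (\<rho> (k n)) * z))) \<longlonglongrightarrow> Re (h z)"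
    if "h holomorphic_on ball 0 1" "z \<in> ball 0 1" for h :: "complex \<Rightarrow> complex" and z
  proof -
    have "isCont h z"
      using that(2) holomorphic_on_imp_continuous_on[OF that(1)]
      by (simp add: continuous_on_eq_continuous_at)
    moreover have "(\<lambda>n. of_real (\<rho> (k n)) * z) \<longlonglongrightarrow> of_real 1 * z"
      using LIMSEQ_subseq_LIMSEQ[OF \<rho>_lim k] by (intro tendsto_intros) (simp add: o_def)
    ultimately show ?thesis
      by (intro tendsto_Re isCont_tendsto_compose[of z h]) auto
  qed
  show ?thesis
  proof (intro exI[of _ f] conjI ballI allI impI f)
    fix z :: complex assume z: "z \<in> ball 0 1"
    show "Re (f z) \<le> 0"
      using tendsto_Re[OF lim[OF z]] by (rule tendsto_upperbound) (use F_le z in auto)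
    show "Re (f z) \<le> Re (b z)"
      using scale_lim[OF b z] tendsto_Re[OF lim[OF z]]
      by (rule tendsto_le[OF sequentially_bot]) (use F_le z in auto)
  next
    fix N z assume N: "N holomorphic_on ball 0 1" "\<forall>z\<in>ball 0 1. Re (N z) \<le> 0 \<and> Re (N z) \<le> Re (b z)"
      and z: "z \<in> ball (0::complex) 1"
    show "Re (N z) \<le> Re (f z)"
      using tendsto_Re[OF lim[OF z]] scale_lim[OF N(1) z]
      by (rule tendsto_le[OF sequentially_bot]) (use le_F[OF N] z in auto)
  qed
qed

section \<open>Lipschitz bounds and reflection across the real axis\<close>

text \<open>Passing to \<open>exp (\<i> f / M)\<close> turns the bound on \<open>Im f\<close> into two-sided bounds on a modulus.\<close>

lemma cmod_deriv_le_if_Im_bounded: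
  assumes f: "f holomorphic_on ball z s" and "0 < s" "0 < M"
    and M: "\<And>w. w \<in> ball z s \<Longrightarrow> \<bar>Im (f w)\<bar> \<le> M"
  shows "cmod (deriv f z) \<le> 2 * exp 2 * M / s"
proof -
  define g where "g = (\<lambda>w. exp (\<i> * f w / of_real M))"
  have g_norm: "cmod (g w) = exp (- Im (f w) / M)" for w
    by (simp add: g_def)
  have g: "g holomorphic_on ball z s"
    unfolding g_def using \<open>0 < M\<close> by (intro holomorphic_intros f) auto
  \<comment> \<open>Half the radius keeps the closed disc inside \<open>ball z s\<close> and
    produces the factor 2. The bound \<open>exp 1\<close> on the circle and the bound
    \<open>exp (- 1)\<close> at the centre combine to \<open>exp 2\<close>.\<close>
  have "cmod ((deriv ^^ 1) g z) \<le> fact 1 * exp 1 / (s / 2)^1"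
  proof (rule Cauchy_inequality)
    show "g holomorphic_on ball z (s / 2)"
      by (rule holomorphic_on_subset[OF g]) (use \<open>0 < s\<close> in auto)
    show "continuous_on (cball z (s / 2)) g"
      by (intro holomorphic_on_imp_continuous_on holomorphic_on_subset[OF g]) (use \<open>0 < s\<close> in auto)
    fix w assume "cmod (z - w) = s / 2"
    then have "w \<in> ball z s"
      using \<open>0 < s\<close> by (simp add: dist_norm)
    then have "- Im (f w) \<le> M"
      using M by (meson abs_le_D2)
    then show "cmod (g w) \<le> exp 1"
      unfolding g_norm using \<open>0 < M\<close> by (simp add: field_simps)
  qed (use \<open>0 < s\<close> in auto)
  then have upper: "cmod (deriv g z) \<le> 2 * exp 1 / s"
    by (simp add: mult.commute)
  have "(f has_field_derivative deriv f z) (at z)"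
    using \<open>0 < s\<close> by (intro holomorphic_derivI[OF f]) auto
  then have "(g has_field_derivative g z * (\<i> * deriv f z / of_real M)) (at z)"
    unfolding g_def using \<open>0 < M\<close> by (auto intro!: derivative_eq_intros)
  then have "deriv g z = g z * (\<i> * deriv f z / of_real M)"
    by (rule DERIV_imp_deriv)
  then have "cmod (deriv g z) = cmod (g z) * (cmod (deriv f z) / M)"
    using \<open>0 < M\<close> by (simp add: norm_mult norm_divide)
  moreover have "exp (- 1) \<le> cmod (g z)"
  proof -
    have "Im (f z) \<le> M"
      using M[of z] \<open>0 < s\<close> by simp
    then show ?thesis
      unfolding g_norm using \<open>0 < M\<close> by (simp add: field_simps)
  qed
  then have "exp (- 1) * (cmod (deriv f z) / M) \<le> cmod (g z) * (cmod (deriv f z) / M)"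
    using \<open>0 < M\<close> by (intro mult_right_mono) auto
  ultimately have "exp (- 1) * (cmod (deriv f z) / M) \<le> 2 * exp 1 / s"
    using upper by linarith
  then have "exp 1 * (exp (- 1) * (cmod (deriv f z) / M)) \<le> exp 1 * (2 * exp 1 / s)"
    by (intro mult_left_mono) auto
  moreover have "exp 1 * (exp (- 1) * (cmod (deriv f z) / M)) = cmod (deriv f z) / M"
    by (simp add: mult.assoc[symmetric] exp_add[symmetric])
  moreover have "exp 1 * (2 * exp 1 / s) = 2 * exp 2 / s"
    by (simp add: exp_add[symmetric])
  ultimately have "cmod (deriv f z) / M \<le> 2 * exp 2 / s"
    by linarith
  then show ?thesis
    using \<open>0 < M\<close> by (simp add: pos_divide_le_eq)
qed

text \<open>On the disc of radius \<open>Im v\<close> about \<open>v\<close> the imaginary part of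
  \<open>f\<close> is at most \<open>2 * C * Im v\<close>. In the derivative estimate the height
  \<open>Im v\<close> cancels, so the bound is uniform up to the real axis. The doubled radius in
  the assumption leaves room for these discs.\<close>

lemma lipschitz_if_Im_le_Im:
  assumes f: "f holomorphic_on ball x (2 * \<rho>) \<inter> {z. 0 < Im z}" and "0 < \<rho>" "Im x = 0" "0 < C"
    and C: "\<And>z. z \<in> ball x (2 * \<rho>) \<Longrightarrow> 0 < Im z \<Longrightarrow> \<bar>Im (f z)\<bar> \<le> C * Im z"
    and zw: "z \<in> ball x \<rho> \<inter> {z. 0 < Im z}" "w \<in> ball x \<rho> \<inter> {z. 0 < Im z}"
  shows "cmod (f z - f w) \<le> 4 * exp 2 * C * cmod (z - w)"
proof (rule field_differentiable_bound)
  show "convex (ball x \<rho> \<inter> {z. 0 < Im z})"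
    by (intro convex_Int convex_ball convex_halfspace_Im_gt)
next
  fix v assume v: "v \<in> ball x \<rho> \<inter> {z. 0 < Im z}"
  have "Im v \<le> cmod (x - v)"
    using abs_Im_le_cmod[of "x - v"] \<open>Im x = 0\<close> by simp
  then have Im_v: "Im v < \<rho>"
    using v by (simp add: dist_norm)
  have sub: "ball v (Im v) \<subseteq> ball x (2 * \<rho>) \<inter> {z. 0 < Im z \<and> Im z \<le> 2 * Im v}"
  proof
    fix u assume u: "u \<in> ball v (Im v)"
    then have "\<bar>Im (u - v)\<bar> < Im v"
      using abs_Im_le_cmod[of "u - v"] by (simp add: dist_norm norm_minus_commute)
    moreover have "dist x u < 2 * \<rho>"
      using u v Im_v dist_triangle[of x u v] by simp
    ultimately show "u \<in> ball x (2 * \<rho>) \<inter> {z. 0 < Im z \<and> Im z \<le> 2 * Im v}"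
      by auto
  qed
  show "(f has_field_derivative deriv f v) (at v within ball x \<rho> \<inter> {z. 0 < Im z})"
    by (rule holomorphic_derivI[OF f])
       (use v \<open>0 < \<rho>\<close> in \<open>auto intro!: open_Int open_halfspace_Im_gt\<close>)
  have "cmod (deriv f v) \<le> 2 * exp 2 * (2 * C * Im v) / Im v"
  proof (rule cmod_deriv_le_if_Im_bounded)
    show "f holomorphic_on ball v (Im v)"
      by (rule holomorphic_on_subset[OF f]) (use sub in auto)
    fix u assume "u \<in> ball v (Im v)"
    then have u: "u \<in> ball x (2 * \<rho>)" "0 < Im u" "Im u \<le> 2 * Im v"
      using sub by auto
    have "C * Im u \<le> C * (2 * Im v)"
      using u(3) \<open>0 < C\<close> by (intro mult_left_mono) auto
    then show "\<bar>Im (f u)\<bar> \<le> 2 * C * Im v"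
      using C[OF u(1,2)] by simp
  qed (use v \<open>0 < C\<close> in auto)
  then show "cmod (deriv f v) \<le> 4 * exp 2 * C"
    using v by simp
qed (use zw in auto)

text \<open>Schwarz reflection when only the imaginary part is controlled at the real axis; the Lipschitz
  bound supplies the continuous extension.\<close>

lemma Schwarz_reflection_Im:
  assumes "open \<Omega>" and cnj_\<Omega>: "cnj ` \<Omega> \<subseteq> \<Omega>" and \<psi>: "\<psi> holomorphic_on \<Omega> \<inter> {z. 0 < Im z}"
    and loc: "\<And>x. x \<in> \<Omega> \<Longrightarrow> Im x = 0 \<Longrightarrow>
      \<exists>\<rho>>0. \<exists>C. \<forall>z\<in>ball x \<rho>. z \<in> \<Omega> \<longrightarrow> 0 < Im z \<longrightarrow> \<bar>Im (\<psi> z)\<bar> \<le> C * Im z"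
  obtains \<phi> where "\<phi> holomorphic_on \<Omega>" "\<And>z. z \<in> \<Omega> \<Longrightarrow> 0 < Im z \<Longrightarrow> \<phi> z = \<psi> z"
    "\<And>z. z \<in> \<Omega> \<Longrightarrow> Im z = 0 \<Longrightarrow> Im (\<phi> z) = 0" "\<And>z. z \<in> \<Omega> \<Longrightarrow> \<phi> (cnj z) = cnj (\<phi> z)"
proof -
  define e where "e = (\<lambda>n. \<i> * of_real (inverse (real (Suc n))))"
  have e_lim: "(\<lambda>n. z + e n) \<longlonglongrightarrow> z" for z
    unfolding e_def by (rule tendsto_eq_intros LIMSEQ_inverse_real_of_nat refl)+ simp
  have Im_e0: "Im (e n) = inverse (real (Suc n))" for n
    by (simp add: e_def del: of_nat_Suc of_real_inverse)
  then have Im_e: "Im (z + e n) = Im z + inverse (real (Suc n))" for z n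
    by simp
  have e_nonzero: "e n \<noteq> 0" for n
    using Im_e[of 0 n] by (auto simp del: of_nat_Suc)
  have Im_pos: "0 < Im (z + e n)" if "0 \<le> Im z" for z n
    unfolding Im_e using that by (simp add: add_nonneg_pos del: of_nat_Suc)
  \<comment> \<open>Vertical limits give one formula for the closed upper half: it reproduces
    \<open>\<psi>\<close> inside by continuity and defines the boundary values on the axis.\<close>
  define \<phi>0 where "\<phi>0 = (\<lambda>z. lim (\<lambda>n. \<psi> (z + e n)))"
  have openH: "open (\<Omega> \<inter> {z. 0 < Im z})"
    by (intro open_Int \<open>open \<Omega>\<close> open_halfspace_Im_gt)
  have \<psi>_cont: "continuous_on (\<Omega> \<inter> {z. 0 < Im z}) \<psi>"
    by (rule holomorphic_on_imp_continuous_on[OF \<psi>])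
  have eqH: "\<phi>0 z = \<psi> z" if "z \<in> \<Omega> \<inter> {z. 0 < Im z}" for z
  proof -
    have "isCont \<psi> z"
      using \<psi>_cont openH that by (auto simp: continuous_on_eq_continuous_at)
    then have "(\<lambda>n. \<psi> (z + e n)) \<longlonglongrightarrow> \<psi> z"
      by (rule isCont_tendsto_compose[OF _ e_lim])
    then show ?thesis
      unfolding \<phi>0_def by (rule limI)
  qed
  have real: "continuous (at x within \<Omega> \<inter> {z. 0 \<le> Im z}) \<phi>0 \<and> Im (\<phi>0 x) = 0"
    if x: "x \<in> \<Omega>" "Im x = 0" for x
  proof -
    obtain \<rho>1 C1 where \<rho>1: "0 < \<rho>1"
      and C1: "\<And>z. z \<in> ball x \<rho>1 \<Longrightarrow> z \<in> \<Omega> \<Longrightarrow> 0 < Im z \<Longrightarrow> \<bar>Im (\<psi> z)\<bar> \<le> C1 * Im z"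
      using loc[OF x] by blast
    obtain \<rho>2 where \<rho>2: "0 < \<rho>2" "ball x \<rho>2 \<subseteq> \<Omega>"
      using \<open>open \<Omega>\<close> x(1) open_contains_ball by blast
    define \<rho> where "\<rho> = min \<rho>1 \<rho>2 / 2"
    define C where "C = max 1 C1"
    have \<rho>: "0 < \<rho>" "ball x (2 * \<rho>) \<subseteq> \<Omega>" "ball x (2 * \<rho>) \<subseteq> ball x \<rho>1"
      using \<rho>1 \<rho>2 by (auto simp: \<rho>_def)
    have C: "\<bar>Im (\<psi> z)\<bar> \<le> C * Im z" if "z \<in> ball x (2 * \<rho>)" "0 < Im z" for z
    proof -
      have "C1 * Im z \<le> C * Im z"
        using that(2) by (intro mult_right_mono) (auto simp: C_def)
      moreover have "z \<in> ball x \<rho>1" "z \<in> \<Omega>"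
        using \<rho>(2,3) that(1) by blast+
      ultimately show ?thesis
        using C1[of z] that(2) by linarith
    qed
    have "0 < C"
      by (simp add: C_def)
    define V where "V = ball x \<rho> \<inter> {z. 0 < Im z}"
    define V' where "V' = ball x \<rho> \<inter> {z. 0 \<le> Im z}"
    have ev: "eventually (\<lambda>n. z + e n \<in> V) sequentially" if "z \<in> V'" for z
    proof -
      have "eventually (\<lambda>n. z + e n \<in> ball x \<rho>) sequentially"
        using topological_tendstoD[OF e_lim open_ball, of z x \<rho>] that by (simp add: V'_def)
      then show ?thesis
        by (rule eventually_mono) (use that Im_pos in \<open>auto simp: V_def V'_def simp del: plus_complex.sel\<close>)
    qed
    have lip: "cmod (\<psi> z - \<psi> w) \<le> 4 * exp 2 * C * cmod (z - w)" if "z \<in> V" "w \<in> V" for z w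
      by (rule lipschitz_if_Im_le_Im[OF holomorphic_on_subset[OF \<psi>] \<rho>(1) x(2) \<open>0 < C\<close> C])
         (use \<rho>(2) that in \<open>auto simp: V_def\<close>)
    \<comment> \<open>Uniform continuity extends \<open>\<psi>\<close> to the closure of the half
      disc; the vertical limits agree with this extension, so \<open>\<phi>0\<close> is continuous
      at the real point.\<close>
    have "uniformly_continuous_on V \<psi>"
      unfolding uniformly_continuous_on_def
    proof (intro allI impI)
      fix \<epsilon> :: real assume "0 < \<epsilon>"
      show "\<exists>d>0. \<forall>z\<in>V. \<forall>w\<in>V. dist w z < d \<longrightarrow> dist (\<psi> w) (\<psi> z) < \<epsilon>"
      proof (intro exI[of _ "\<epsilon> / (4 * exp 2 * C)"] conjI ballI impI)
        fix z w assume zw: "z \<in> V" "w \<in> V" "dist w z < \<epsilon> / (4 * exp 2 * C)"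
        have "dist (\<psi> w) (\<psi> z) \<le> 4 * exp 2 * C * dist w z"
          using lip[OF zw(2,1)] by (simp add: dist_norm)
        also have "\<dots> < \<epsilon>"
          using zw(3) \<open>0 < C\<close> by (simp add: field_simps)
        finally show "dist (\<psi> w) (\<psi> z) < \<epsilon>" .
      qed (use \<open>0 < \<epsilon>\<close> \<open>0 < C\<close> in auto)
    qed
    then obtain g where g: "uniformly_continuous_on (closure V) g" "\<And>z. z \<in> V \<Longrightarrow> \<psi> z = g z"
      using uniformly_continuous_on_extension_on_closure by metis
    have V'_closure: "z \<in> closure V" if "z \<in> V'" for z
    proof -
      have "eventually (\<lambda>n. z + e n \<in> V) sequentially"
        by (rule ev[OF that])
      then obtain N where "\<And>n. n \<ge> N \<Longrightarrow> z + e n \<in> V"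
        by (auto simp: eventually_sequentially)
      then show ?thesis
        unfolding closure_sequential
        by (intro exI[of _ "\<lambda>n. z + e (n + N)"] conjI allI LIMSEQ_ignore_initial_segment[OF e_lim]) auto
    qed
    have lim_g: "(\<lambda>n. \<psi> (z + e n)) \<longlonglongrightarrow> g z" if "z \<in> V'" for z
    proof -
      have "(g \<longlongrightarrow> g z) (at z within closure V)"
        using uniformly_continuous_imp_continuous[OF g(1)] V'_closure[OF that]
        by (auto simp: continuous_on_def)
      moreover have "filterlim (\<lambda>n. z + e n) (at z within closure V) sequentially"
        unfolding filterlim_at
        using ev[OF that] e_lim[of z] closure_subset[of V]
        by (auto elim!: eventually_mono simp: e_nonzero)
      ultimately have "(\<lambda>n. g (z + e n)) \<longlonglongrightarrow> g z"
        by (rule filterlim_compose)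
      then show ?thesis
        by (rule Lim_transform_eventually) (use ev[OF that] g(2) in \<open>auto elim!: eventually_mono\<close>)
    qed
    have \<phi>0_g: "\<phi>0 z = g z" if "z \<in> V'" for z
      unfolding \<phi>0_def by (rule limI[OF lim_g[OF that]])
    have "x \<in> V'"
      using x(2) \<rho>(1) by (simp add: V'_def)
    have "continuous_on V' \<phi>0"
      using continuous_on_subset[OF uniformly_continuous_imp_continuous[OF g(1)], of V'] V'_closure
      by (auto simp: \<phi>0_g cong: continuous_on_cong)
    then have "continuous (at x within V') \<phi>0"
      using \<open>x \<in> V'\<close> by (simp add: continuous_on_eq_continuous_within)
    moreover have "at x within \<Omega> \<inter> {z. 0 \<le> Im z} = at x within V'"
      using \<rho>(1,2) by (intro at_within_nhd[of x "ball x \<rho>"]) (auto simp: V'_def)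
    moreover have "Im (\<phi>0 x) = 0"
    proof -
      have "(\<lambda>n. Im (\<psi> (x + e n))) \<longlonglongrightarrow> Im (\<phi>0 x)"
        unfolding \<phi>0_g[OF \<open>x \<in> V'\<close>] by (intro tendsto_Im lim_g \<open>x \<in> V'\<close>)
      moreover have "(\<lambda>n. Im (\<psi> (x + e n))) \<longlonglongrightarrow> 0"
      proof (rule Lim_null_comparison)
        show "eventually (\<lambda>n. norm (Im (\<psi> (x + e n))) \<le> C * inverse (real (Suc n))) sequentially"
          using ev[OF \<open>x \<in> V'\<close>]
        proof (rule eventually_mono)
          fix n assume "x + e n \<in> V"
          then show "norm (Im (\<psi> (x + e n))) \<le> C * inverse (real (Suc n))"
            using C[of "x + e n"] \<rho>(1) x(2) by (simp add: V_def Im_e0 del: of_nat_Suc)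
        qed
        show "(\<lambda>n. C * inverse (real (Suc n))) \<longlonglongrightarrow> 0"
          using tendsto_mult_left[OF LIMSEQ_inverse_real_of_nat, of C] by simp
      qed
      ultimately show ?thesis
        using LIMSEQ_unique by blast
    qed
    ultimately show ?thesis
      by simp
  qed
  have "continuous_on (\<Omega> \<inter> {z. 0 \<le> Im z}) \<phi>0"
    unfolding continuous_on_eq_continuous_within
  proof
    fix z assume z: "z \<in> \<Omega> \<inter> {z. 0 \<le> Im z}"
    show "continuous (at z within \<Omega> \<inter> {z. 0 \<le> Im z}) \<phi>0"
    proof (cases "Im z = 0")
      case True
      then show ?thesis
        using real z by blast
    next
      case False
      then have "z \<in> \<Omega> \<inter> {z. 0 < Im z}"
        using z by auto
      moreover have "continuous_on (\<Omega> \<inter> {z. 0 < Im z}) \<phi>0"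
        by (rule iffD2[OF continuous_on_cong[OF refl eqH] \<psi>_cont])
      ultimately show ?thesis
        using openH continuous_at_imp_continuous_at_within
        by (auto simp: continuous_on_eq_continuous_at)
    qed
  qed
  moreover have "\<phi>0 holomorphic_on \<Omega> \<inter> {z. 0 < Im z}"
    by (rule iffD2[OF holomorphic_cong[OF refl eqH] \<psi>])
  ultimately have hol: "(\<lambda>z. if 0 \<le> Im z then \<phi>0 z else cnj (\<phi>0 (cnj z))) holomorphic_on \<Omega>"
    by (intro Schwarz_reflection \<open>open \<Omega>\<close> cnj_\<Omega>) (use real in \<open>auto simp: complex_is_Real_iff\<close>)
  show thesis
  proof (rule that[OF hol])
    fix z assume z: "z \<in> \<Omega>"
    show "(if 0 \<le> Im (cnj z) then \<phi>0 (cnj z) else cnj (\<phi>0 (cnj (cnj z)))) =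
      cnj (if 0 \<le> Im z then \<phi>0 z else cnj (\<phi>0 (cnj z)))"
    proof (cases "Im z = 0")
      case True
      then have "cnj z = z" "cnj (\<phi>0 z) = \<phi>0 z"
        using real[OF z] by (auto simp: complex_eq_iff)
      then show ?thesis
        using True by simp
    qed auto
  qed (use eqH real in auto)
qed

section \<open>A competitor from the greatest harmonic minorant\<close>

text \<open>The vertical projection \<open>u\<close> of \<open>z\<close> to the real axis stays in
  the disc, \<open>f u\<close> is real, and the mean value estimate on the segment from
  \<open>u\<close> to \<open>z\<close> has length \<open>\<bar>Im z\<bar>\<close>.\<close>

lemma abs_Im_le_if_real_on_real:
  assumes f: "f holomorphic_on S" "open S" "cball x \<rho> \<subseteq> S" "Im x = 0"
    and real: "\<And>z. z \<in> cball x \<rho> \<Longrightarrow> Im z = 0 \<Longrightarrow> Im (f z) = 0"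
  shows "\<exists>C>0. \<forall>z\<in>cball x \<rho>. \<bar>Im (f z)\<bar> \<le> C * \<bar>Im z\<bar>"
proof -
  have "continuous_on (cball x \<rho>) (deriv f)"
    by (rule continuous_on_subset[OF holomorphic_on_imp_continuous_on[OF holomorphic_deriv[OF f(1,2)]] f(3)])
  then have "bounded (deriv f ` cball x \<rho>)"
    by (intro compact_imp_bounded compact_continuous_image compact_cball)
  then obtain B where B: "0 < B" "\<And>z. z \<in> cball x \<rho> \<Longrightarrow> cmod (deriv f z) \<le> B"
    unfolding bounded_pos by blast
  have "\<bar>Im (f z)\<bar> \<le> B * \<bar>Im z\<bar>" if z: "z \<in> cball x \<rho>" for z
  proof -
    define u where "u = complex_of_real (Re z)"
    have "\<bar>Re z - Re x\<bar> \<le> cmod (z - x)"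
      using abs_Re_le_cmod[of "z - x"] by simp
    moreover have "x - u = of_real (Re x - Re z)"
      using \<open>Im x = 0\<close> by (simp add: u_def complex_eq_iff)
    then have "cmod (x - u) = \<bar>Re x - Re z\<bar>"
      by (metis norm_of_real)
    ultimately have u: "u \<in> cball x \<rho>"
      using z by (simp add: dist_norm norm_minus_commute)
    have "cmod (f z - f u) \<le> B * cmod (z - u)"
    proof (rule field_differentiable_bound[OF convex_cball _ B(2) z u])
      fix w assume "w \<in> cball x \<rho>"
      then show "(f has_field_derivative deriv f w) (at w within cball x \<rho>)"
        using f(3) by (intro holomorphic_derivI[OF f(1,2)]) auto
    qed
    moreover have "z - u = \<i> * of_real (Im z)"
      by (simp add: u_def complex_eq_iff)
    then have "cmod (z - u) = \<bar>Im z\<bar>"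
      by (simp add: norm_mult)
    moreover have "Im (f u) = 0"
      using real[OF u] by (simp add: u_def)
    ultimately show ?thesis
      using abs_Im_le_cmod[of "f z - f u"] by simp
  qed
  then show ?thesis
    using B(1) by blast
qed

lemma half_plane_to_disc:
  assumes "0 < Re G"
  shows "cmod ((G - 1) / (G + 1)) < 1" "(1 + (G - 1) / (G + 1)) / (1 - (G - 1) / (G + 1)) = G"
proof -
  have ne: "G + 1 \<noteq> 0"
    using assms by (auto simp: complex_eq_iff)
  have "(cmod (G - 1))\<^sup>2 < (cmod (G + 1))\<^sup>2"
    using assms by (simp add: cmod_power2) (simp add: power2_eq_square algebra_simps)
  then have "cmod (G - 1) < cmod (G + 1)"
    by (rule power2_less_imp_less) simp
  then show "cmod ((G - 1) / (G + 1)) < 1"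
    using ne by (simp add: norm_divide)
  show "(1 + (G - 1) / (G + 1)) / (1 - (G - 1) / (G + 1)) = G"
  proof -
    have "1 + (G - 1) / (G + 1) = 2 * G / (G + 1)" "1 - (G - 1) / (G + 1) = 2 / (G + 1)"
      using ne by (simp_all add: divide_simps)
    then show ?thesis
      using ne by simp
  qed
qed

text \<open>With \<open>t = (z - x) / \<rho>\<close>, \<open>- Im (cayley_log (- t))\<close> is the harmonic measure (times \<open>\<pi>\<close>) of
  the real points outside \<open>[x - \<rho>, x + \<rho>]\<close>; it is at least \<open>\<pi> / 2\<close> outside the half disc.\<close>

lemma Im_cayley_log_half_disc:
  assumes "0 < Im t"
  shows "1 \<le> cmod t \<Longrightarrow> Im (cayley_log (- t)) \<le> - pi / 2"
    and "cmod t < 1 \<Longrightarrow> Im (cayley_log (- t)) \<le> - Im t"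
    and "(1 + (- t)) / (1 - (- t)) \<notin> \<real>\<^sub>\<le>\<^sub>0"
proof -
  define \<zeta> where "\<zeta> = (1 + (- t)) / (1 - (- t))"
  have ne: "1 + t \<noteq> 0" "1 - t \<noteq> 0"
    using assms by (auto simp: complex_eq_iff)
  then have pos: "0 < (cmod (1 - (- t)))\<^sup>2"
    by simp
  have "Im \<zeta> < 0"
    unfolding \<zeta>_def Im_cayley using assms pos by (simp add: divide_neg_pos)
  then have "\<zeta> \<noteq> 0"
    by auto
  show nonpos: "(1 + (- t)) / (1 - (- t)) \<notin> \<real>\<^sub>\<le>\<^sub>0"
    using \<open>Im \<zeta> < 0\<close> unfolding \<zeta>_def by (auto simp: complex_nonpos_Reals_iff)
  have Ln_neg: "Im (Ln \<zeta>) < 0"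
    using Im_Ln_pos_le[OF \<open>\<zeta> \<noteq> 0\<close>] \<open>Im \<zeta> < 0\<close> Im_Ln_le_pi[OF \<open>\<zeta> \<noteq> 0\<close>] by linarith
  show "Im (cayley_log (- t)) \<le> - pi / 2" if "1 \<le> cmod t"
  proof -
    have "1 - (cmod (- t))\<^sup>2 \<le> 0"
      using that by simp
    then have "Re \<zeta> \<le> 0"
      unfolding \<zeta>_def Re_cayley using pos by (simp add: divide_nonpos_pos)
    then have "pi / 2 \<le> \<bar>Im (Ln \<zeta>)\<bar>"
      using Re_Ln_pos_lt[OF \<open>\<zeta> \<noteq> 0\<close>] by linarith
    then show ?thesis
      using Ln_neg by (simp add: cayley_log_def \<zeta>_def)
  qed
  show "Im (cayley_log (- t)) \<le> - Im t" if "cmod t < 1"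
  proof -
    have "cmod (1 - t\<^sup>2) \<le> 1 + (cmod t)\<^sup>2"
      by (metis norm_one norm_power norm_triangle_ineq4)
    also have "(cmod t)\<^sup>2 \<le> 1"
      using that by (simp add: power_le_one)
    finally have le2: "cmod (1 + t) * cmod (1 - t) \<le> 2"
      by (simp add: norm_mult[symmetric] algebra_simps power2_eq_square)
    have "\<bar>Im \<zeta>\<bar> / cmod \<zeta> = 2 * Im t / (cmod (1 + t) * cmod (1 - t))"
    proof -
      have "\<bar>Im \<zeta>\<bar> = 2 * Im t / (cmod (1 + t))\<^sup>2"
        unfolding \<zeta>_def Im_cayley using assms by simp
      moreover have "cmod \<zeta> = cmod (1 - t) / cmod (1 + t)"
        by (simp add: \<zeta>_def norm_divide)
      ultimately show ?thesis
        using ne by (simp add: power2_eq_square)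
    qed
    also have "\<dots> \<ge> 2 * Im t / 2"
      using le2 assms ne by (intro divide_left_mono) auto
    finally have "Im t \<le> \<bar>Im (Ln \<zeta>)\<bar>"
      using abs_Im_Ln_ge[OF \<open>\<zeta> \<noteq> 0\<close>] by simp
    then show ?thesis
      using Ln_neg by (simp add: cayley_log_def \<zeta>_def)
  qed
qed

section \<open>Topology of \<open>U\<close>, harmonic minorants on it and the competitor they
  give\<close>

context real_pole_function
begin

text \<open>Folding along the real axis maps \<open>X\<close> onto \<open>Y\<close>, so
  \<open>Y\<close> is connected, and \<open>U\<close> is dense in \<open>Y\<close>. A separation of
  \<open>U\<close> would give two pieces whose closures meet at a point of \<open>Y\<close>; but
  near each such point \<open>X\<close> contains a disc, whose upper part is convex and would meet
  both pieces.\<close>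

lemma connected_U:
  assumes "connected X"
  shows "connected U"
proof (rule ccontr)
  define Y where "Y = X \<inter> {z. 0 \<le> Im z}"
  assume "\<not> connected U"
  then obtain A B where AB: "open A" "open B" "U \<subseteq> A \<union> B" "A \<inter> B \<inter> U = {}" "A \<inter> U \<noteq> {}" "B \<inter> U \<noteq> {}"
    unfolding connected_def by blast
  have "Y = (\<lambda>z. Complex (Re z) \<bar>Im z\<bar>) ` X"
  proof
    show "Y \<subseteq> (\<lambda>z. Complex (Re z) \<bar>Im z\<bar>) ` X"
      by (force simp: Y_def complex_eq_iff)
    show "(\<lambda>z. Complex (Re z) \<bar>Im z\<bar>) ` X \<subseteq> Y"
    proof safe
      fix z assume "z \<in> X"
      have "Complex (Re z) \<bar>Im z\<bar> = (if 0 \<le> Im z then z else cnj z)"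
        by (simp add: complex_eq_iff)
      then show "Complex (Re z) \<bar>Im z\<bar> \<in> Y"
        using \<open>z \<in> X\<close> by (simp add: Y_def cnj_X_iff)
    qed
  qed
  moreover have "continuous_on X (\<lambda>z. Complex (Re z) \<bar>Im z\<bar>)"
    by (intro continuous_intros)
  ultimately have "connected Y"
    using assms connected_continuous_image by metis
  have near: "\<exists>d>0. ball x d \<subseteq> X" if "x \<in> X" for x
    using open_X that open_contains_ball by blast
  have "Y \<subseteq> closure U"
  proof
    fix x assume "x \<in> Y"
    then obtain d where d: "0 < d" "ball x d \<subseteq> X" and x: "0 \<le> Im x"
      using near by (auto simp: Y_def)
    show "x \<in> closure U"
      unfolding closure_approachable
    proof (intro allI impI)
      fix e :: real assume "0 < e"
      define y where "y = x + \<i> * of_real (min d e / 2)"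
      have dxy: "dist y x = min d e / 2"
        using d(1) \<open>0 < e\<close> by (simp add: y_def dist_norm norm_mult del: of_real_divide)
      then have "y \<in> ball x d"
        using d(1) \<open>0 < e\<close> by (simp add: dist_commute)
      moreover have "0 < Im y"
        using x d(1) \<open>0 < e\<close> by (simp add: y_def del: of_real_divide)
      ultimately have "y \<in> U"
        using d(2) by (auto simp: U_def)
      moreover have "dist y x < e"
        using dxy d(1) \<open>0 < e\<close> by linarith
      ultimately show "\<exists>y\<in>U. dist y x < e"
        by blast
    qed
  qed
  also have "U = (A \<inter> U) \<union> (B \<inter> U)"
    using AB by blast
  then have "closure U = closure (A \<inter> U) \<union> closure (B \<inter> U)"
    by (metis closure_Un)
  finally have "Y \<subseteq> closure (A \<inter> U) \<union> closure (B \<inter> U)" .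
  moreover have "closure (A \<inter> U) \<inter> Y \<noteq> {}" "closure (B \<inter> U) \<inter> Y \<noteq> {}"
    using AB(5,6) closure_subset by (fastforce simp: Y_def U_def)+
  ultimately have "closure (A \<inter> U) \<inter> closure (B \<inter> U) \<inter> Y \<noteq> {}"
    using \<open>connected Y\<close> unfolding connected_closed by (meson closed_closure)
  then obtain x where x: "x \<in> closure (A \<inter> U)" "x \<in> closure (B \<inter> U)" "x \<in> X"
    by (auto simp: Y_def)
  obtain d where d: "0 < d" "ball x d \<subseteq> X"
    using near[OF x(3)] by blast
  define V where "V = ball x d \<inter> {z. 0 < Im z}"
  have "connected V"
    unfolding V_def by (intro convex_connected convex_Int convex_ball convex_halfspace_Im_gt)
  moreover have "V \<subseteq> U"
    using d(2) by (auto simp: V_def U_def)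
  moreover have "A \<inter> V \<noteq> {}" "B \<inter> V \<noteq> {}"
    using x(1,2) d(1) unfolding closure_approachable by (fastforce simp: V_def U_def dist_commute)+
  ultimately show False
    using AB(1-4) unfolding connected_def by blast
qed

lemma simply_connected_U:
  assumes "connected X"
  shows "simply_connected U"
  unfolding simply_connected_eq_unbounded_complement_components[OF open_U]
proof (intro conjI connected_U assms ballI notI)
  fix C assume C: "C \<in> components (- U)" and "bounded C"
  have "closed (- U)"
    using open_U by (simp add: closed_def)
  \<comment> \<open>The closed lower half plane is connected, unbounded and disjoint from
    \<open>U\<close>, so a bounded component cannot meet it.\<close>
  have "C \<subseteq> {z. 0 < Im z}"
  proof (rule ccontr)
    assume "\<not> C \<subseteq> {z. 0 < Im z}"
    then have "{z. Im z \<le> 0} \<inter> C \<noteq> {}"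
      by force
    moreover have "connected {z. Im z \<le> 0}"
      by (intro convex_connected convex_halfspace_Im_le)
    moreover have "{z. Im z \<le> 0} \<subseteq> - U"
      by (auto simp: U_def)
    ultimately have "{z. Im z \<le> 0} \<subseteq> C"
      using components_maximal[OF C, of "{z. Im z \<le> 0}"] by blast
    then obtain B where B: "\<And>z. Im z \<le> 0 \<Longrightarrow> cmod z \<le> B"
      using \<open>bounded C\<close> by (auto simp: bounded_iff)
    have "cmod (of_real (\<bar>B\<bar> + 1)) \<le> B"
      by (rule B) simp
    then show False
      by (subst (asm) norm_of_real) simp
  qed
  moreover have "compact C"
    using C \<open>bounded C\<close> \<open>closed (- U)\<close> closed_components compact_eq_bounded_closed by blast
  \<comment> \<open>A component need not be relatively open in \<open>- U\<close>. The Sura-Bura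
    theorem encloses it in a compact relatively open set, which is then the superlevel set |r| \<ge>
    1 in an open part of the upper half plane.\<close>
  ultimately obtain K where K: "openin (top_of_set (- U)) K" "compact K" "C \<subseteq> K" "K \<subseteq> {z. 0 < Im z}"
    using Sura_Bura_clopen_subset[OF closed_imp_locally_compact[OF \<open>closed (- U)\<close>] C _ open_halfspace_Im_gt]
    by metis
  then obtain T where T: "open T" "K = - U \<inter> T"
    unfolding openin_open by blast
  have no_pole: "z \<notin> P" if "0 < Im z" for z
    using P_real that complex_is_Real_iff by force
  have K_eq: "K = {z \<in> T \<inter> {z. 0 < Im z}. 1 \<le> cmod (r z)}"
    using T(2) K(4) no_pole by (auto simp: U_def X_def)
  obtain z where "z \<in> C"
    using in_components_nonempty[OF C] by blast
  then have "z \<in> K"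
    using K(3) by blast
  have "cmod (r z) < 1"
  proof (rule compact_superlevel_empty[of "T \<inter> {z. 0 < Im z}" r 1 z])
    show "open (T \<inter> {z. 0 < Im z})"
      by (intro open_Int T open_halfspace_Im_gt)
    show "r holomorphic_on T \<inter> {z. 0 < Im z}"
      by (rule holomorphic_on_subset[OF holomorphic_r]) (use no_pole in auto)
  qed (use K(2) \<open>z \<in> K\<close> K_eq in auto)
  then show False
    using \<open>z \<in> K\<close> K_eq by simp
qed

text \<open>Order relations between harmonic functions are conformally invariant, so a Riemann map
  transports the result from the disc; the factor \<open>- \<i>\<close> turns imaginary parts into
  real parts. Testing against holomorphic \<open>N\<close> loses nothing on a simply connected
  set.\<close>

lemma greatest_harmonic_minorant_U:
  assumes "connected X"
  shows "\<exists>\<psi>. \<psi> holomorphic_on U \<and> (\<forall>z\<in>U. Im (\<psi> z) \<le> 0 \<and> Im (\<psi> z) \<le> Im (cayley_log (r z))) \<and>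
    (\<forall>N. N holomorphic_on U \<longrightarrow> (\<forall>z\<in>U. Im (N z) \<le> 0 \<and> Im (N z) \<le> Im (cayley_log (r z))) \<longrightarrow>
       (\<forall>z\<in>U. Im (N z) \<le> Im (\<psi> z)))"
proof -
  obtain R where R: "0 < R" "\<And>z. R < cmod z \<Longrightarrow> z \<in> X"
    using exists_radius by blast
  \<comment> \<open>\<open>U\<close> is neither empty nor the plane, the two exceptional cases of
    the Riemann mapping theorem.\<close>
  have "\<i> * of_real (R + 1) \<in> U"
    using R by (auto simp: U_def norm_mult simp del: of_real_add)
  moreover have "0 \<notin> U"
    by (simp add: U_def)
  ultimately obtain \<Phi> \<Theta> where \<Phi>: "\<Phi> holomorphic_on U" "\<And>z. z \<in> U \<Longrightarrow> \<Phi> z \<in> ball 0 1 \<and> \<Theta> (\<Phi> z) = z"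
    and \<Theta>: "\<Theta> holomorphic_on ball 0 1" "\<And>z. z \<in> ball 0 1 \<Longrightarrow> \<Theta> z \<in> U \<and> \<Phi> (\<Theta> z) = z"
    using simply_connected_U[OF assms] unfolding simply_connected_eq_biholomorphic_to_disc[OF open_U] by blast
  define b where "b = (\<lambda>z. - \<i> * cayley_log (r (\<Theta> z)))"
  have U_X: "U \<subseteq> X"
    by (auto simp: U_def)
  have comp: "(\<lambda>z. h (\<Theta> z)) holomorphic_on ball 0 1" if "h holomorphic_on U" for h
    by (rule holomorphic_on_compose_gen[OF \<Theta>(1) that, unfolded o_def]) (use \<Theta>(2) in auto)
  have b: "b holomorphic_on ball 0 1"
    unfolding b_def by (intro holomorphic_intros comp[OF holomorphic_on_subset[OF holomorphic_cayley_log_r U_X]])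
  have "\<bar>Re (b z)\<bar> \<le> pi / 2" if "z \<in> ball 0 1" for z
    using Im_cayley_log_less[OF X_norm_less, of "\<Theta> z"] \<Theta>(2)[OF that] U_X by (auto simp: b_def)
  from greatest_harmonic_minorant_disc[OF b this] obtain f where f: "f holomorphic_on ball 0 1"
    "\<And>z. z \<in> ball 0 1 \<Longrightarrow> Re (f z) \<le> 0 \<and> Re (f z) \<le> Re (b z)"
    "\<And>N z. N holomorphic_on ball 0 1 \<Longrightarrow> \<forall>z\<in>ball 0 1. Re (N z) \<le> 0 \<and> Re (N z) \<le> Re (b z) \<Longrightarrow>
       z \<in> ball 0 1 \<Longrightarrow> Re (N z) \<le> Re (f z)"
    by blast
  define \<psi> where "\<psi> = (\<lambda>z. \<i> * f (\<Phi> z))"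
  show ?thesis
  proof (intro exI[of _ \<psi>] conjI ballI allI impI)
    have "(\<lambda>z. f (\<Phi> z)) holomorphic_on U"
      by (rule holomorphic_on_compose_gen[OF \<Phi>(1) f(1), unfolded o_def]) (use \<Phi>(2) in auto)
    then show "\<psi> holomorphic_on U"
      unfolding \<psi>_def by (intro holomorphic_intros)
  next
    fix z assume "z \<in> U"
    then show "Im (\<psi> z) \<le> 0" "Im (\<psi> z) \<le> Im (cayley_log (r z))"
      using f(2)[of "\<Phi> z"] \<Phi>(2)[of z] by (auto simp: \<psi>_def b_def)
  next
    fix N z assume N: "N holomorphic_on U" "\<forall>z\<in>U. Im (N z) \<le> 0 \<and> Im (N z) \<le> Im (cayley_log (r z))"
      and z: "z \<in> U"
    have "Re (- \<i> * N (\<Theta> (\<Phi> z))) \<le> Re (f (\<Phi> z))"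
    proof (rule f(3))
      show "(\<lambda>z. - \<i> * N (\<Theta> z)) holomorphic_on ball 0 1"
        by (intro holomorphic_intros comp N)
      show "\<forall>z\<in>ball 0 1. Re (- \<i> * N (\<Theta> z)) \<le> 0 \<and> Re (- \<i> * N (\<Theta> z)) \<le> Re (b z)"
        using N(2) \<Theta>(2) by (auto simp: b_def)
      show "\<Phi> z \<in> ball 0 1"
        using \<Phi>(2)[OF z] by blast
    qed
    then show "Im (N z) \<le> Im (\<psi> z)"
      using \<Phi>(2)[OF z] by (simp add: \<psi>_def)
  qed
qed

text \<open>The greatest minorant dominates any explicit one. The barrier \<open>N\<close>, a
  multiple of a harmonic measure, lies below \<open>- |Im L(r)|\<close> on all of \<open>U\<close>,
  yet extends analytically across \<open>x\<close> with real values on the axis; hence it decays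
  only linearly there.\<close>

lemma Im_minorant_ge_near_real:
  assumes x: "x \<in> X" "Im x = 0"
    and \<psi>: "\<And>N z. N holomorphic_on U \<Longrightarrow> (\<And>z. z \<in> U \<Longrightarrow> Im (N z) \<le> 0 \<and> Im (N z) \<le> Im (cayley_log (r z)))
      \<Longrightarrow> z \<in> U \<Longrightarrow> Im (N z) \<le> Im (\<psi> z)"
  shows "\<exists>\<rho>>0. \<exists>C. \<forall>z\<in>ball x \<rho>. z \<in> X \<longrightarrow> 0 < Im z \<longrightarrow> - (C * Im z) \<le> Im (\<psi> z)"
proof -
  obtain \<rho> where \<rho>: "0 < \<rho>" "cball x \<rho> \<subseteq> X"
    using open_X x(1) open_contains_cball by blast
  obtain C where C: "0 < C" "\<And>z. z \<in> cball x \<rho> \<Longrightarrow> \<bar>Im (cayley_log (r z))\<bar> \<le> C * \<bar>Im z\<bar>"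
    using abs_Im_le_if_real_on_real[OF holomorphic_cayley_log_r open_X \<rho>(2) x(2)] Im_cayley_log_r_real \<rho>(2)
    by blast
  \<comment> \<open>The factor 1 suffices outside the half disc, where the harmonic measure already
    beats \<open>pi / 2\<close>. Inside, \<open>C * \<rho>\<close> converts
    \<open>Im t = Im z / \<rho>\<close> into \<open>C * Im z\<close>.\<close>
  define M where "M = max 1 (C * \<rho>)"
  define t where "t = (\<lambda>z. (z - x) / of_real \<rho>)"
  define N where "N = (\<lambda>z. of_real M * cayley_log (- t z))"
  have Im_t: "Im (t z) = Im z / \<rho>" for z
    using x(2) \<rho>(1) by (simp add: t_def Im_divide_of_real)
  have cmod_t: "cmod (t z) = dist x z / \<rho>" for z
    using \<rho>(1) by (simp add: t_def norm_divide dist_norm norm_minus_commute)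
  have M: "1 \<le> M" "C * \<rho> \<le> M"
    by (auto simp: M_def)
  have t_hol: "t holomorphic_on S" for S
    unfolding t_def using \<rho>(1) by (intro holomorphic_intros) auto
  have "N holomorphic_on U"
    unfolding N_def cayley_log_def
  proof (intro holomorphic_intros t_hol)
    fix z assume "z \<in> U"
    then have "0 < Im (t z)"
      using \<rho>(1) by (simp add: Im_t U_def)
    then show "(1 + - t z) / (1 - - t z) \<notin> \<real>\<^sub>\<le>\<^sub>0"
      by (rule Im_cayley_log_half_disc(3))
    from \<open>0 < Im (t z)\<close> show "1 - - t z \<noteq> 0"
      by (auto simp: complex_eq_iff)
  qed
  moreover have "Im (N z) \<le> 0 \<and> Im (N z) \<le> Im (cayley_log (r z))" if "z \<in> U" for z
  proof -
    have z: "z \<in> X" "0 < Im z"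
      using that by (auto simp: U_def)
    then have t_pos: "0 < Im (t z)"
      using \<rho>(1) by (simp add: Im_t)
    have "Im (N z) \<le> - \<bar>Im (cayley_log (r z))\<bar>"
    proof (cases "1 \<le> cmod (t z)")
      case True
      have neg: "Im (cayley_log (- t z)) \<le> - pi / 2"
        by (rule Im_cayley_log_half_disc(1)[OF t_pos True])
      moreover have "Im (cayley_log (- t z)) \<le> 0"
        using neg pi_gt_zero by linarith
      then have "M * Im (cayley_log (- t z)) \<le> 1 * Im (cayley_log (- t z))"
        using M(1) by (intro mult_right_mono_neg) auto
      ultimately show ?thesis
        using Im_cayley_log_less[OF X_norm_less[OF z(1)]] by (simp add: N_def)
    next
      case False
      then have "z \<in> cball x \<rho>"
        using \<rho>(1) by (simp add: cmod_t)
      have "M * Im (cayley_log (- t z)) \<le> M * (- Im (t z))"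
        using False M(1) by (intro mult_left_mono Im_cayley_log_half_disc(2) t_pos) auto
      also have "\<dots> \<le> C * \<rho> * (- Im (t z))"
        using M(2) t_pos by (intro mult_right_mono_neg) auto
      also have "\<dots> = - (C * \<bar>Im z\<bar>)"
        using \<rho>(1) z(2) by (simp add: Im_t)
      also have "\<dots> \<le> - \<bar>Im (cayley_log (r z))\<bar>"
        using C(2)[OF \<open>z \<in> cball x \<rho>\<close>] by simp
      finally show ?thesis
        by (simp add: N_def)
    qed
    then show ?thesis
      by linarith
  qed
  ultimately have N_le: "Im (N z) \<le> Im (\<psi> z)" if "z \<in> U" for z
    using \<psi> that by blast
  have "N holomorphic_on ball x \<rho>"
    unfolding N_def using \<rho>(1) by (intro holomorphic_intros t_hol) (simp add: cmod_t)
  moreover have "cball x (\<rho> / 2) \<subseteq> ball x \<rho>"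
    using \<rho>(1) by auto
  moreover have "Im (N z) = 0" if "z \<in> cball x (\<rho> / 2)" "Im z = 0" for z
  proof -
    have "cmod (- t z) < 1"
      using that(1) \<rho>(1) by (simp add: cmod_t)
    moreover have "cnj (- t z) = - t z"
      using that(2) by (simp add: complex_eq_iff Im_t)
    ultimately have "cayley_log (- t z) = cnj (cayley_log (- t z))"
      using cayley_log_cnj[of "- t z"] by simp
    then show ?thesis
      by (simp add: N_def complex_eq_iff)
  qed
  ultimately obtain C' where C': "\<And>z. z \<in> cball x (\<rho> / 2) \<Longrightarrow> \<bar>Im (N z)\<bar> \<le> C' * \<bar>Im z\<bar>"
    using abs_Im_le_if_real_on_real[of N "ball x \<rho>" x "\<rho> / 2"] x(2) by blast
  have "- (C' * Im z) \<le> Im (\<psi> z)" if z: "z \<in> ball x (\<rho> / 2)" "z \<in> X" "0 < Im z" for z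
  proof -
    have "\<bar>Im (N z)\<bar> \<le> C' * \<bar>Im z\<bar>"
      using z by (intro C') auto
    moreover have "Im (N z) \<le> Im (\<psi> z)"
      using z by (intro N_le) (simp add: U_def)
    ultimately show ?thesis
      using z(3) by simp
  qed
  moreover have "0 < \<rho> / 2"
    using \<rho>(1) by simp
  ultimately show ?thesis
    by blast
qed

text \<open>\<open>\<phi>\<close> is, up to a real constant, \<open>cayley_log\<close> of the Ahlfors function of \<open>X\<close>.\<close>

lemma exists_symmetric_minorant:
  assumes "connected X"
  obtains \<phi> where "\<phi> holomorphic_on X" "\<And>z. z \<in> X \<Longrightarrow> \<phi> (cnj z) = cnj (\<phi> z)"
    "\<And>z. z \<in> X \<Longrightarrow> \<bar>Im (\<phi> z)\<bar> \<le> pi / 2"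
    "\<And>z. z \<in> U \<Longrightarrow> Im (\<phi> z) \<le> 0" "\<And>z. z \<in> U \<Longrightarrow> Im (\<phi> z) \<le> Im (cayley_log (r z))"
proof -
  obtain \<psi> where \<psi>: "\<psi> holomorphic_on U" "\<And>z. z \<in> U \<Longrightarrow> Im (\<psi> z) \<le> 0 \<and> Im (\<psi> z) \<le> Im (cayley_log (r z))"
    and max: "\<And>N z. N holomorphic_on U \<Longrightarrow> (\<And>z. z \<in> U \<Longrightarrow> Im (N z) \<le> 0 \<and> Im (N z) \<le> Im (cayley_log (r z)))
      \<Longrightarrow> z \<in> U \<Longrightarrow> Im (N z) \<le> Im (\<psi> z)"
    using greatest_harmonic_minorant_U[OF assms] by blast
  have lower: "- (pi / 2) \<le> Im (\<psi> z)" if "z \<in> U" for z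
  proof -
    \<comment> \<open>The constant \<open>- pi / 2\<close> is itself a minorant, so the greatest one
      stays in the strip.\<close>
    have "Im (- \<i> * of_real (pi / 2)) \<le> Im (\<psi> z)"
    proof (rule max[OF _ _ that])
      fix z assume "z \<in> U"
      then have "\<bar>Im (cayley_log (r z))\<bar> < pi / 2"
        by (intro Im_cayley_log_less X_norm_less) (simp add: U_def)
      then show "Im (- \<i> * of_real (pi / 2)) \<le> 0 \<and> Im (- \<i> * of_real (pi / 2)) \<le> Im (cayley_log (r z))"
        by (auto simp del: of_real_divide)
    qed simp
    then show ?thesis
      by (simp del: of_real_divide)
  qed
  have cnj_X: "cnj ` X \<subseteq> X"
    by (auto simp: cnj_X_iff)
  have loc: "\<exists>\<rho>>0. \<exists>C. \<forall>z\<in>ball x \<rho>. z \<in> X \<longrightarrow> 0 < Im z \<longrightarrow> \<bar>Im (\<psi> z)\<bar> \<le> C * Im z"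
    if x: "x \<in> X" "Im x = 0" for x
  proof -
    have "\<exists>\<rho>>0. \<exists>C. \<forall>z\<in>ball x \<rho>. z \<in> X \<longrightarrow> 0 < Im z \<longrightarrow> - (C * Im z) \<le> Im (\<psi> z)"
    proof (rule Im_minorant_ge_near_real[OF x])
      fix N z assume N: "N holomorphic_on U" "z \<in> U"
        "\<And>z. z \<in> U \<Longrightarrow> Im (N z) \<le> 0 \<and> Im (N z) \<le> Im (cayley_log (r z))"
      show "Im (N z) \<le> Im (\<psi> z)"
        by (rule max[OF N(1,3,2)])
    qed
    then obtain \<rho> C where \<rho>: "0 < \<rho>"
      and C: "\<And>z. z \<in> ball x \<rho> \<Longrightarrow> z \<in> X \<Longrightarrow> 0 < Im z \<Longrightarrow> - (C * Im z) \<le> Im (\<psi> z)"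
      by blast
    have "\<bar>Im (\<psi> z)\<bar> \<le> C * Im z" if "z \<in> ball x \<rho>" "z \<in> X" "0 < Im z" for z
      using C[OF that] \<psi>(2)[of z] that by (simp add: U_def)
    then show ?thesis
      using \<rho> by blast
  qed
  obtain \<phi> where \<phi>: "\<phi> holomorphic_on X" "\<And>z. z \<in> X \<Longrightarrow> 0 < Im z \<Longrightarrow> \<phi> z = \<psi> z"
    "\<And>z. z \<in> X \<Longrightarrow> Im z = 0 \<Longrightarrow> Im (\<phi> z) = 0" "\<And>z. z \<in> X \<Longrightarrow> \<phi> (cnj z) = cnj (\<phi> z)"
    using Schwarz_reflection_Im[OF open_X cnj_X \<psi>(1)[unfolded U_def] loc] by blast
  have up: "\<bar>Im (\<phi> z)\<bar> \<le> pi / 2" if "z \<in> X" "0 \<le> Im z" for z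
  proof (cases "Im z = 0")
    case False
    then have "z \<in> U"
      using that by (simp add: U_def)
    then show ?thesis
      using \<psi>(2)[of z] lower[of z] \<phi>(2)[of z] by (simp add: U_def)
  qed (use \<phi>(3) that in simp)
  have "\<bar>Im (\<phi> z)\<bar> \<le> pi / 2" if "z \<in> X" for z
    using up[of z] up[of "cnj z"] \<phi>(4)[of z] that by (cases "0 \<le> Im z") (auto simp: cnj_X_iff)
  then show thesis
    using that \<phi> \<psi>(2) by (auto simp: U_def)
qed

text \<open>Two defects of \<open>\<phi>\<close> have to be repaired: its values may touch the edges
  of the strip, and it need not tend to 0 at infinity. The first is excluded by the maximum modulus
  principle, because symmetry makes \<open>\<phi>\<close> real at real points. The second costs only
  a real constant, since symmetry also makes the limit of \<open>T\<close> real.\<close>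

lemma competitor_of_symmetric_strip_function:
  assumes "connected X" and \<phi>: "\<phi> holomorphic_on X" "\<And>z. z \<in> X \<Longrightarrow> \<phi> (cnj z) = cnj (\<phi> z)"
    "\<And>z. z \<in> X \<Longrightarrow> \<bar>Im (\<phi> z)\<bar> \<le> pi / 2"
  obtains g where "g holomorphic_on X" "\<And>z. z \<in> X \<Longrightarrow> cmod (g z) < 1" "(g \<longlongrightarrow> 0) at_infinity"
    "\<And>z. z \<in> X \<Longrightarrow> Im (cayley_log (g z)) = Im (\<phi> z)"
proof -
  obtain R where R: "0 < R" "\<And>z. R < cmod z \<Longrightarrow> z \<in> X"
    using exists_radius by blast
  define G where "G = (\<lambda>z. exp (\<phi> z))"
  define T where "T = (\<lambda>z. (G z - 1) / (G z + 1))"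
  have Re_G: "0 \<le> Re (G z)" if "z \<in> X" for z
    using \<phi>(3)[OF that] by (auto simp: G_def Re_exp intro!: mult_nonneg_nonneg cos_ge_zero)
  have G1: "G z + 1 \<noteq> 0" if "z \<in> X" for z
    using Re_G[OF that] by (auto simp: complex_eq_iff)
  have T: "T holomorphic_on X"
    unfolding T_def G_def
    by (intro holomorphic_intros \<phi>) (use G1 in \<open>auto simp: G_def\<close>)
  have T_le: "cmod (T z) \<le> 1" if "z \<in> X" for z
  proof -
    have "(cmod (G z - 1))\<^sup>2 \<le> (cmod (G z + 1))\<^sup>2"
      using Re_G[OF that] by (simp add: cmod_power2) (simp add: power2_eq_square algebra_simps)
    then have "cmod (G z - 1) \<le> cmod (G z + 1)"
      by (rule power2_le_imp_le) simp
    then show ?thesis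
      using G1[OF that] by (simp add: T_def norm_divide)
  qed
  have T_real: "cmod (T x) < 1" if "x \<in> X" "Im x = 0" for x
  proof -
    have "cnj x = x"
      using that(2) by (simp add: complex_eq_iff)
    then have "Im (\<phi> x) = 0"
      using \<phi>(2)[OF that(1)] unfolding \<open>cnj x = x\<close> by (simp add: complex_eq_iff)
    then have "0 < Re (G x)"
      by (simp add: G_def Re_exp)
    then show ?thesis
      unfolding T_def by (rule half_plane_to_disc(1))
  qed
  \<comment> \<open>A point of modulus 1 would make \<open>T\<close> constant, but at the real point
    \<open>R + 1\<close> of \<open>X\<close> its modulus is below 1.\<close>
  have T_less: "cmod (T z) < 1" if "z \<in> X" for z
  proof (rule ccontr)
    assume "\<not> cmod (T z) < 1"
    then have z1: "cmod (T z) = 1"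
      using T_le[OF that] by simp
    have "T constant_on X"
      by (rule maximum_modulus_principle[OF T open_X assms(1) open_X order_refl that]) (use T_le z1 in simp)
    moreover have x: "of_real (R + 1) \<in> X"
      using R by (auto simp del: of_real_add)
    ultimately have "cmod (T (of_real (R + 1))) = 1"
      using z1 that by (metis constant_on_def)
    then show False
      using T_real[OF x] by (simp del: of_real_add)
  qed
  have Re_G_pos: "0 < Re (G z)" if "z \<in> X" for z
  proof -
    have "0 < Re ((1 + T z) / (1 - T z))"
      by (rule Re_cayley_pos[OF T_less[OF that]])
    moreover have "(1 + T z) / (1 - T z) = G z"
    proof -
      have "1 + T z = 2 * G z / (G z + 1)" "1 - T z = 2 / (G z + 1)"
        using G1[OF that] by (simp_all add: T_def divide_simps)
      then show ?thesis
        using G1[OF that] by simp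
    qed
    ultimately show ?thesis by simp
  qed
  define S where "S = ball (0::complex) (1 / R)"
  have S: "inverse w \<in> X" if "w \<in> S - {0}" for w
    using that R(1) by (intro R(2)) (auto simp: S_def norm_divide divide_simps mult.commute)
  have "(\<lambda>w. T (inverse w)) holomorphic_on S - {0}"
    by (rule holomorphic_on_compose_gen[OF _ T, unfolded o_def]) (use S in \<open>auto intro!: holomorphic_intros\<close>)
  moreover have "0 \<in> interior S"
    using R(1) by (simp add: S_def)
  moreover have "eventually (\<lambda>w. cmod (T (inverse w)) \<le> 1) (at 0)"
    unfolding eventually_at_topological
    by (rule exI[of _ S]) (use S T_le R(1) in \<open>auto simp: S_def\<close>)
  ultimately obtain k where k: "k holomorphic_on S" "\<And>w. w \<in> S - {0} \<Longrightarrow> k w = T (inverse w)"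
    using holomorphic_on_extend_bounded[of "\<lambda>w. T (inverse w)" S 0] by blast
  have "0 \<in> S" "open S" "connected S"
    using R(1) by (auto simp: S_def)
  have "isCont k 0"
    using holomorphic_on_imp_continuous_on[OF k(1)] \<open>0 \<in> S\<close> \<open>open S\<close> by (simp add: continuous_on_eq_continuous_at)
  define l where "l = k 0"
  have "(k \<longlongrightarrow> l) (at 0)"
    using \<open>isCont k 0\<close> by (simp add: l_def isCont_def)
  moreover have "eventually (\<lambda>w. k w = T (inverse w)) (at 0)"
    unfolding eventually_at_topological using k(2) \<open>0 \<in> S\<close> \<open>open S\<close> by (intro exI[of _ S]) auto
  ultimately have "((\<lambda>w. T (inverse w)) \<longlongrightarrow> l) (at 0)"
    by (rule Lim_transform_eventually)
  then have T_inf: "(T \<longlongrightarrow> l) at_infinity"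
    by (simp add: lim_at_infinity_0 o_def)
  have "Im l = 0"
  proof -
    have lim: "((\<lambda>z. cnj (T z)) \<longlongrightarrow> cnj l) at_infinity"
      by (intro tendsto_cnj T_inf)
    have "eventually (\<lambda>z. cnj (T z) = T (cnj z)) at_infinity"
      using R by (intro eventually_at_infinityI[of "R + 1"]) (auto simp: T_def G_def \<phi>(2) exp_cnj)
    from tendsto_unique[OF trivial_limit_at_infinity Lim_transform_eventually[OF lim this]
        filterlim_compose[OF T_inf filterlim_cnj_at_infinity]]
    have "cnj l = l" .
    then show ?thesis
      by (simp add: complex_eq_iff)
  qed
  \<comment> \<open>The value at infinity needs its own maximum modulus argument, for the extension
    \<open>k\<close> in the inverted coordinate.\<close>
  have "cmod l < 1"
  proof (rule ccontr)
    have k_le: "cmod (k w) \<le> 1" if "w \<in> S" for w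
    proof (cases "w = 0")
      case True
      have "cmod l \<le> 1"
        by (rule tendsto_upperbound[OF tendsto_norm[OF T_inf] _ trivial_limit_at_infinity])
           (use R T_le in \<open>auto intro!: eventually_at_infinityI[of "R + 1"]\<close>)
      then show ?thesis
        using True by (simp add: l_def)
    qed (use k(2) S T_le that in simp)
    assume "\<not> cmod l < 1"
    then have l1: "cmod (k 0) = 1"
      using k_le[OF \<open>0 \<in> S\<close>] by (simp add: l_def)
    have "k constant_on S"
      by (rule maximum_modulus_principle[OF k(1) \<open>open S\<close> \<open>connected S\<close> \<open>open S\<close> order_refl \<open>0 \<in> S\<close>])
         (use k_le l1 in simp)
    moreover have w: "complex_of_real (1 / (2 * R)) \<in> S - {0}"
      unfolding S_def mem_ball_0 using R(1) by (simp add: norm_divide divide_simps)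
    ultimately have "cmod (k (of_real (1 / (2 * R)))) = 1"
      using l1 \<open>0 \<in> S\<close> by (metis DiffD1 constant_on_def)
    then show False
      using T_less[OF S[OF w]] k(2)[OF w] by simp
  qed
  define \<tau> where "\<tau> = Re l"
  have l: "l = of_real \<tau>" "\<bar>\<tau>\<bar> < 1"
    using \<open>Im l = 0\<close> \<open>cmod l < 1\<close> abs_Re_le_cmod[of l] by (auto simp: \<tau>_def complex_eq_iff)
  \<comment> \<open>Dilating the half plane by \<open>\<kappa>\<close> is the disc automorphism that
    moves \<open>\<tau>\<close> to 0, and it adds only the real number \<open>ln \<kappa>\<close> to
    \<open>\<phi>\<close>.\<close>
  define \<kappa> where "\<kappa> = (1 - \<tau>) / (1 + \<tau>)"
  have "0 < \<kappa>"
    using l(2) by (simp add: \<kappa>_def)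
  define g where "g = (\<lambda>z. (of_real \<kappa> * G z - 1) / (of_real \<kappa> * G z + 1))"
  have Re_kG: "0 < Re (of_real \<kappa> * G z)" if "z \<in> X" for z
    using Re_G_pos[OF that] \<open>0 < \<kappa>\<close> by simp
  show thesis
  proof (rule that)
    have "of_real \<kappa> * G z + 1 \<noteq> 0" if "z \<in> X" for z
      using Re_kG[OF that] by (auto simp: complex_eq_iff)
    then show "g holomorphic_on X"
      unfolding g_def G_def by (intro holomorphic_intros \<phi>) (auto simp: G_def)
    show "cmod (g z) < 1" if "z \<in> X" for z
      unfolding g_def by (rule half_plane_to_disc(1)[OF Re_kG[OF that]])
    show "Im (cayley_log (g z)) = Im (\<phi> z)" if "z \<in> X" for z
    proof -
      have "cayley_log (g z) = Ln (of_real \<kappa> * G z)"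
        unfolding cayley_log_def g_def half_plane_to_disc(2)[OF Re_kG[OF that]] ..
      also have "of_real \<kappa> * G z = exp (of_real (ln \<kappa>) + \<phi> z)"
        using \<open>0 < \<kappa>\<close> by (simp add: exp_add G_def exp_of_real)
      also have "Ln (exp (of_real (ln \<kappa>) + \<phi> z)) = of_real (ln \<kappa>) + \<phi> z"
      proof (rule Ln_exp)
        have "- (pi / 2) \<le> Im (\<phi> z)" "Im (\<phi> z) \<le> pi / 2"
          using \<phi>(3)[OF that] by linarith+
        then have "- pi < Im (\<phi> z)" "Im (\<phi> z) \<le> pi"
          using pi_gt_zero by linarith+
        then show "- pi < Im (of_real (ln \<kappa>) + \<phi> z)" "Im (of_real (ln \<kappa>) + \<phi> z) \<le> pi"
          by simp_all
      qed
      finally show ?thesis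
        by simp
    qed
    have "((\<lambda>z. (T z - of_real \<tau>) / (1 - of_real \<tau> * T z)) \<longlongrightarrow> (l - of_real \<tau>) / (1 - of_real \<tau> * l)) at_infinity"
    proof (intro tendsto_intros T_inf)
      have "\<tau> * \<tau> \<noteq> 1"
        using l(2) by (metis abs_square_less_1 less_irrefl power2_eq_square)
      then show "1 - of_real \<tau> * l \<noteq> 0"
        unfolding l(1) by (metis eq_iff_diff_eq_0 of_real_1 of_real_eq_iff of_real_mult)
    qed
    then have "((\<lambda>z. (T z - of_real \<tau>) / (1 - of_real \<tau> * T z)) \<longlongrightarrow> 0) at_infinity"
      by (simp add: l(1))
    moreover have "eventually (\<lambda>z. (T z - of_real \<tau>) / (1 - of_real \<tau> * T z) = g z) at_infinity"
    proof (rule eventually_at_infinityI[of "R + 1"])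
      fix z assume "R + 1 \<le> cmod z"
      then have z: "z \<in> X"
        by (intro R(2)) simp
      define \<Lambda> where "\<Lambda> = complex_of_real \<tau>"
      have \<Lambda>: "1 + \<Lambda> \<noteq> 0" "1 - \<Lambda> \<noteq> 0" "of_real \<kappa> = (1 - \<Lambda>) / (1 + \<Lambda>)"
        using l(2) by (auto simp: \<Lambda>_def \<kappa>_def complex_eq_iff)
      have n: "T z - \<Lambda> = ((1 - \<Lambda>) * G z - (1 + \<Lambda>)) / (G z + 1)"
        "1 - \<Lambda> * T z = ((1 - \<Lambda>) * G z + (1 + \<Lambda>)) / (G z + 1)"
        using G1[OF z] by (simp_all add: T_def divide_simps) (simp_all add: algebra_simps)
      have m: "of_real \<kappa> * G z - 1 = ((1 - \<Lambda>) * G z - (1 + \<Lambda>)) / (1 + \<Lambda>)"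
        "of_real \<kappa> * G z + 1 = ((1 - \<Lambda>) * G z + (1 + \<Lambda>)) / (1 + \<Lambda>)"
        using \<Lambda>(1) unfolding \<Lambda>(3) by (simp_all add: divide_simps)
      show "(T z - of_real \<tau>) / (1 - of_real \<tau> * T z) = g z"
        unfolding g_def m \<Lambda>_def[symmetric] n using G1[OF z] \<Lambda>(1) by simp
    qed
    ultimately show "(g \<longlongrightarrow> 0) at_infinity"
      by (rule Lim_transform_eventually)
  qed
qed

lemma competitor_derivative_exists:
  assumes "g holomorphic_on X" "(g \<longlongrightarrow> 0) at_infinity"
  shows "\<exists>c. ((\<lambda>z. z * g z) \<longlongrightarrow> c) at_infinity"
proof -
  obtain R where R: "0 < R" "\<And>z. R < cmod z \<Longrightarrow> z \<in> X"
    using exists_radius by blast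
  then have "{z. R < cmod z} \<subseteq> X"
    by blast
  from holomorphic_extension_at_infinity(2)[OF R(1) holomorphic_on_subset[OF assms(1) this] assms(2)]
  show ?thesis by auto
qed

lemma Im_r_nonpos_if_maximal:
  assumes "connected X" and A: "((\<lambda>z. z * r z) \<longlongrightarrow> A) at_infinity"
    and max: "\<And>g c. g holomorphic_on X \<Longrightarrow> (\<And>z. z \<in> X \<Longrightarrow> cmod (g z) < 1) \<Longrightarrow> (g \<longlongrightarrow> 0) at_infinity \<Longrightarrow>
      ((\<lambda>z. z * g z) \<longlongrightarrow> c) at_infinity \<Longrightarrow> Re c \<le> Re A"
    and "z \<in> U"
  shows "Im (r z) \<le> 0"
proof -
  obtain \<phi> where \<phi>: "\<phi> holomorphic_on X" "\<And>z. z \<in> X \<Longrightarrow> \<phi> (cnj z) = cnj (\<phi> z)"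
    "\<And>z. z \<in> X \<Longrightarrow> \<bar>Im (\<phi> z)\<bar> \<le> pi / 2"
    "\<And>z. z \<in> U \<Longrightarrow> Im (\<phi> z) \<le> 0" "\<And>z. z \<in> U \<Longrightarrow> Im (\<phi> z) \<le> Im (cayley_log (r z))"
    using exists_symmetric_minorant[OF assms(1)] by blast
  obtain g where g: "g holomorphic_on X" "\<And>z. z \<in> X \<Longrightarrow> cmod (g z) < 1" "(g \<longlongrightarrow> 0) at_infinity"
    "\<And>z. z \<in> X \<Longrightarrow> Im (cayley_log (g z)) = Im (\<phi> z)"
    using competitor_of_symmetric_strip_function[OF assms(1) \<phi>(1-3)] by blast
  obtain R where R: "0 < R" "\<And>z. R < cmod z \<Longrightarrow> z \<in> X"
    using exists_radius by blast
  obtain c where c: "((\<lambda>z. z * g z) \<longlongrightarrow> c) at_infinity"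
    using competitor_derivative_exists[OF g(1,3)] by blast
  \<comment> \<open>Here \<open>L(g)\<close> has the smaller imaginary part, so the dichotomy at
    infinity gives \<open>Re A < Re c\<close> or \<open>F = 0\<close>; maximality leaves only the
    second case.\<close>
  define F where "F = (\<lambda>z. cayley_log (r z) - cayley_log (g z))"
  have F: "F holomorphic_on X"
    unfolding F_def by (intro holomorphic_intros holomorphic_cayley_log_r g(1,2))
  have F_inf: "(F \<longlongrightarrow> 0) at_infinity"
    using tendsto_diff[OF cayley_log_r_infinity tendsto_cayley_log_0[OF g(3)]] by (simp add: F_def)
  have Fc: "((\<lambda>z. z * F z) \<longlongrightarrow> 2 * A - 2 * c) at_infinity"
    using tendsto_diff[OF cayley_log_at_infinity[OF r_infinity A] cayley_log_at_infinity[OF g(3) c]]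
    by (simp add: F_def algebra_simps)
  have "(\<forall>z. R < cmod z \<longrightarrow> F z = 0) \<or> Re (2 * A - 2 * c) < 0"
  proof (rule half_plane_boundary_derivative_at_infinity[OF R(1) holomorphic_on_subset[OF F] F_inf _ Fc])
    fix z assume "R < cmod z" "0 < Im z"
    then have "z \<in> X" "z \<in> U"
      using R(2) by (auto simp: U_def)
    then show "0 \<le> Im (F z)"
      using g(4) \<phi>(5) by (simp add: F_def)
  qed (use R(2) in auto)
  moreover have "Re c \<le> Re A"
    by (rule max[OF g(1-3) c])
  ultimately have F0: "\<And>z. R < cmod z \<Longrightarrow> F z = 0"
    by auto
  have zX: "z \<in> X"
    using \<open>z \<in> U\<close> by (simp add: U_def)
  have "F z = 0"
    by (rule eq_on_X_if_eq_near_infinity[OF assms(1) F _ _ R(2) zX]) (use F0 in auto)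
  then have "Im (cayley_log (r z)) = Im (\<phi> z)"
    using g(4)[OF zX] by (simp add: F_def)
  then have "Im (cayley_log (r z)) \<le> 0"
    using \<phi>(4)[OF \<open>z \<in> U\<close>] by simp
  then show ?thesis
    using Im_cayley_log_nonpos_iff[OF X_norm_less[OF zX]] by simp
qed

text \<open>Where \<open>Im r > 0\<close> in the upper half plane, \<open>- 1 / r\<close> is bounded with positive imaginary part,
  but with real boundary values.\<close>

lemma Im_r_nonpos_upper_half_plane:
  assumes U_le: "\<And>z. z \<in> U \<Longrightarrow> Im (r z) \<le> 0" and "0 < Im z"
  shows "Im (r z) \<le> 0"
proof (rule ccontr)
  assume "\<not> Im (r z) \<le> 0"
  define V where "V = {z. 0 < Im z} \<inter> r -` {w. 0 < Im w}"
  \<comment> \<open>The logarithm of the modulus is \<open>Im (- 1 / r)\<close>, that is,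
    \<open>Im r\<close> divided by the square of |r|.\<close>
  define E where "E = (\<lambda>z. exp (\<i> / r z))"
  have no_pole: "z \<notin> P" if "0 < Im z" for z
    using P_real that complex_is_Real_iff by force
  have V_ge: "1 \<le> cmod (r y)" if "y \<in> V" for y
  proof (rule ccontr)
    assume "\<not> 1 \<le> cmod (r y)"
    then have "y \<in> U"
      using that no_pole[of y] by (simp add: V_def U_def X_def)
    then show False
      using U_le[of y] that by (simp add: V_def)
  qed
  have r_hol: "r holomorphic_on {z. 0 < Im z}"
    by (rule holomorphic_on_subset[OF holomorphic_r]) (use no_pole in auto)
  have "open V"
    unfolding V_def
    by (intro continuous_open_preimage holomorphic_on_imp_continuous_on r_hol open_halfspace_Im_gt)
  have E_hol: "E holomorphic_on V"
    unfolding E_def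
    by (intro holomorphic_intros holomorphic_on_subset[OF r_hol]) (use V_ge in \<open>force simp: V_def\<close>)+
  have E_norm: "cmod (E y) = exp (Im (r y) / (cmod (r y))\<^sup>2)" for y
    by (simp add: E_def Re_divide cmod_power2)
  have "z \<in> V"
    using assms(2) \<open>\<not> Im (r z) \<le> 0\<close> by (simp add: V_def)
  define c where "c = cmod (E z)"
  have "1 < c"
    using \<open>\<not> Im (r z) \<le> 0\<close> V_ge[OF \<open>z \<in> V\<close>] unfolding c_def E_norm by (auto intro!: divide_pos_pos)
  define K where "K = {z \<in> V. c \<le> cmod (E z)}"
  \<comment> \<open>The sign on \<open>U\<close> forces |r| \<ge> 1 on \<open>V\<close>, while |r| <
    1 near infinity.\<close>
  have "bounded K"
  proof -
    obtain R where "0 < R" and R: "\<And>z. R < cmod z \<Longrightarrow> z \<in> X"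
      using exists_radius by blast
    have "cmod y \<le> R" if "y \<in> K" for y
      using V_ge[of y] that R[of y] X_norm_less[of y] by (force simp: K_def)
    then show ?thesis
      by (auto simp: bounded_iff)
  qed
  moreover have "x \<in> K" if x: "x \<in> closure K" for x
  proof -
    have freq: "\<not> eventually (\<lambda>y. y \<notin> K) (nhds x)"
      using x by (auto simp: eventually_nhds closure_iff_nhds_not_empty)
    have "x \<notin> P"
    proof
      assume "x \<in> P"
      \<comment> \<open>At a pole \<open>E\<close> tends to 1, which is below \<open>c\<close>;
        hence poles are not limit points of the superlevel set.\<close>
      have "((\<lambda>y. \<i> / r y) \<longlongrightarrow> 0) (at x)"
        by (intro tendsto_divide_0[OF tendsto_const] pole_r \<open>x \<in> P\<close>)
      then have "((\<lambda>y. cmod (E y)) \<longlongrightarrow> cmod (exp 0)) (at x)"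
        unfolding E_def by (intro tendsto_intros)
      then have "eventually (\<lambda>y. cmod (E y) < c) (at x)"
        using \<open>1 < c\<close> by (intro order_tendstoD(2)) auto
      then have "eventually (\<lambda>y. y \<notin> K) (nhds x)"
        unfolding eventually_at_filter
        by (rule eventually_mono) (use \<open>x \<in> P\<close> no_pole in \<open>auto simp: K_def V_def\<close>)
      then show False using freq by blast
    qed
    then have r_x: "filterlim r (nhds (r x)) (nhds x)"
      using isCont_r[of x] by (simp add: isCont_def tendsto_at_iff_tendsto_nhds)
    have "1 \<le> cmod (r x)"
    proof (rule ccontr)
      assume "\<not> 1 \<le> cmod (r x)"
      then have "eventually (\<lambda>y. cmod (r y) < 1) (nhds x)"
        using r_x by (intro order_tendstoD(2)[OF tendsto_norm]) auto
      then have "eventually (\<lambda>y. y \<notin> K) (nhds x)"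
        by (rule eventually_mono) (use V_ge in \<open>force simp: K_def\<close>)
      then show False using freq by blast
    qed
    have "c \<le> cmod (E x)"
    proof (rule ccontr)
      assume "\<not> c \<le> cmod (E x)"
      moreover have "((\<lambda>y. cmod (E y)) \<longlongrightarrow> cmod (E x)) (nhds x)"
        unfolding E_def using \<open>1 \<le> cmod (r x)\<close> by (intro tendsto_intros r_x) auto
      ultimately have "eventually (\<lambda>y. cmod (E y) < c) (nhds x)"
        by (intro order_tendstoD(2)) auto
      then have "eventually (\<lambda>y. y \<notin> K) (nhds x)"
        by (rule eventually_mono) (auto simp: K_def)
      then show False using freq by blast
    qed
    then have "1 < exp (Im (r x) / (cmod (r x))\<^sup>2)"
      using \<open>1 < c\<close> unfolding E_norm by linarith
    then have "0 < Im (r x)"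
      by (simp add: zero_less_divide_iff)
    have "K \<subseteq> {z. 0 \<le> Im z}"
      by (auto simp: K_def V_def)
    then have "0 \<le> Im x"
      using x closure_minimal[OF _ closed_halfspace_Im_ge] by blast
    moreover have "Im x \<noteq> 0"
    proof
      assume "Im x = 0"
      then have "cnj x = x"
        by (simp add: complex_eq_iff)
      then have "Im (r x) = 0"
        using r_cnj[of x] unfolding \<open>cnj x = x\<close> by (simp add: complex_eq_iff)
      then show False
        using \<open>0 < Im (r x)\<close> by simp
    qed
    ultimately show ?thesis
      using \<open>0 < Im (r x)\<close> \<open>c \<le> cmod (E x)\<close> by (simp add: K_def V_def)
  qed
  then have "closed K"
    using closure_subset_eq by blast
  ultimately have "compact K"
    by (simp add: compact_eq_bounded_closed)
  then have "cmod (E z) < c"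
    unfolding K_def by (rule compact_superlevel_empty[OF \<open>open V\<close> E_hol _ \<open>z \<in> V\<close>])
  then show False
    by (simp add: c_def)
qed

end

section \<open>Ahlfors functions on the sphere\<close>

lemma openin_sphere_top:
  "openin sphere_top V \<longleftrightarrow> (\<exists>W. open W \<and> V = Some ` W) \<or> (\<exists>C. compact C \<and> V = insert None (Some ` (- C)))"
  unfolding sphere_top_def openin_Alexandroff_compactification
  by (auto simp: Compl_eq_Diff_UNIV compact_imp_closed)

lemma chart_eq_insert_None:
  "chart_at_infinity -` insert None (Some ` S) = insert 0 {w. w \<noteq> 0 \<and> inverse w \<in> S}"
  by (auto simp: chart_at_infinity_def inverse_eq_divide split: if_splits)

text \<open>By the removable singularity theorem, holomorphy in the chart at infinity amounts to a
  limit condition, so the extremal problem can be treated with functions on the plane.\<close>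

lemma sphere_holomorphic_on_iff:
  assumes "open S" "0 < R" "\<And>z. R < cmod z \<Longrightarrow> z \<in> S"
  shows "sphere_holomorphic_on f (insert None (Some ` S)) \<longleftrightarrow>
    (f \<circ> Some) holomorphic_on S \<and> ((f \<circ> Some) \<longlongrightarrow> f None) at_infinity"
proof -
  define T where "T = insert 0 {w. w \<noteq> 0 \<and> inverse w \<in> S}"
  have vimage: "chart_at_infinity -` insert None (Some ` S) = T" "Some -` insert None (Some ` S) = S"
    unfolding T_def by (simp add: chart_eq_insert_None) auto
  have chart: "f \<circ> chart_at_infinity = (\<lambda>w. if w = 0 then f None else (f \<circ> Some) (inverse w))"
    by (auto simp: chart_at_infinity_def inverse_eq_divide)
  have ball_T: "ball 0 (1 / R) \<subseteq> T"
  proof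
    fix w :: complex assume "w \<in> ball 0 (1 / R)"
    then show "w \<in> T"
      using assms(2) assms(3)[of "inverse w"] by (auto simp: T_def norm_divide divide_simps mult.commute)
  qed
  have T0: "open (T - {0})"
  proof -
    have "T - {0} = (- {0}) \<inter> inverse -` S"
      by (auto simp: T_def)
    moreover have "continuous_on (- {0}) (inverse :: complex \<Rightarrow> complex)"
      by (intro continuous_intros) auto
    ultimately show ?thesis
      using continuous_open_preimage assms(1) by (metis open_Compl closed_singleton)
  qed
  have "T = ball 0 (1 / R) \<union> (T - {0})"
    using ball_T assms(2) by (auto simp: T_def)
  then have "open T"
    using T0 by (metis open_Un open_ball)
  have "0 \<in> T"
    by (simp add: T_def)
  have lim: "((f \<circ> Some) \<longlongrightarrow> f None) at_infinity \<longleftrightarrow> ((\<lambda>w. (f \<circ> Some) (inverse w)) \<longlongrightarrow> f None) (at 0)"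
    by (simp add: lim_at_infinity_0 o_def)
  show ?thesis
  proof
    assume "sphere_holomorphic_on f (insert None (Some ` S))"
    then have hol: "(f \<circ> Some) holomorphic_on S" and "(f \<circ> chart_at_infinity) holomorphic_on T"
      by (auto simp: sphere_holomorphic_on_def vimage)
    then have "isCont (f \<circ> chart_at_infinity) 0"
      using \<open>open T\<close> \<open>0 \<in> T\<close> holomorphic_on_imp_continuous_on continuous_on_eq_continuous_at by blast
    then have "((f \<circ> chart_at_infinity) \<longlongrightarrow> f None) (at 0)"
      by (simp add: isCont_def chart_at_infinity_def)
    then have "((\<lambda>w. (f \<circ> Some) (inverse w)) \<longlongrightarrow> f None) (at 0)"
      by (rule Lim_transform_eventually) (simp add: chart eventually_at_filter)
    then show "(f \<circ> Some) holomorphic_on S \<and> ((f \<circ> Some) \<longlongrightarrow> f None) at_infinity"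
      using hol lim by blast
  next
    assume f: "(f \<circ> Some) holomorphic_on S \<and> ((f \<circ> Some) \<longlongrightarrow> f None) at_infinity"
    have "(\<lambda>w. (f \<circ> Some) (inverse w)) holomorphic_on T - {0}"
      by (rule holomorphic_on_compose_gen[of inverse _ "f \<circ> Some" S, unfolded o_def[of "f \<circ> Some"]])
         (use f in \<open>auto intro!: holomorphic_intros simp: T_def\<close>)
    then have "(\<lambda>w. if w = 0 then f None else (f \<circ> Some) (inverse w)) holomorphic_on T"
      using f lim \<open>open T\<close> by (intro removable_singularity) auto
    then show "sphere_holomorphic_on f (insert None (Some ` S))"
      using f by (simp add: sphere_holomorphic_on_def vimage chart)
  qed
qed

text \<open>Infinity is not a cut point because the exterior of a disc is connected and contained in
  \<open>S\<close>. One part of a separation misses this exterior; the other part, with infinity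
  added, is open in the sphere.\<close>

lemma connected_if_connectedin_sphere:
  assumes conn: "connectedin sphere_top (insert None (Some ` S))"
    and "open S" "\<And>z. R < cmod z \<Longrightarrow> z \<in> S"
  shows "connected S"
proof (rule ccontr)
  assume "\<not> connected S"
  then obtain A B where AB: "open A" "open B" "S \<subseteq> A \<union> B" "A \<inter> B \<inter> S = {}" "A \<inter> S \<noteq> {}" "B \<inter> S \<noteq> {}"
    unfolding connected_def by blast
  have "connected (- cball (0::complex) R)"
    by (intro connected_complement_bounded_convex) auto
  moreover have "- cball 0 R \<subseteq> S"
    using assms(3) by (auto simp: not_le)
  ultimately have "A \<inter> - cball 0 R = {} \<or> B \<inter> - cball 0 R = {}"
    using AB unfolding connected_def by blast
  then obtain A' B' where A'B': "open A'" "open B'" "S \<subseteq> A' \<union> B'" "A' \<inter> B' \<inter> S = {}" "A' \<inter> S \<noteq> {}" "B' \<inter> S \<noteq> {}"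
    "B' \<inter> - cball 0 R = {}"
    using AB by (metis Int_commute Un_commute)
  have "compact (- (A' \<inter> S))"
    unfolding compact_eq_bounded_closed
  proof
    have "- (A' \<inter> S) \<subseteq> cball 0 R"
      using A'B'(3,7) \<open>- cball 0 R \<subseteq> S\<close> by blast
    then show "bounded (- (A' \<inter> S))"
      using bounded_cball bounded_subset by blast
    show "closed (- (A' \<inter> S))"
      by (intro closed_Compl open_Int A'B'(1) \<open>open S\<close>)
  qed
  then have E1: "openin sphere_top (insert None (Some ` (A' \<inter> S)))"
    unfolding openin_sphere_top by (metis double_complement)
  have E2: "openin sphere_top (Some ` (B' \<inter> S))"
    unfolding openin_sphere_top using A'B'(2) \<open>open S\<close> by blast
  have "insert None (Some ` S) \<subseteq> insert None (Some ` (A' \<inter> S)) \<union> Some ` (B' \<inter> S)"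
    using A'B'(3) by auto
  moreover have "insert None (Some ` (A' \<inter> S)) \<inter> Some ` (B' \<inter> S) \<inter> insert None (Some ` S) = {}"
    using A'B'(4) by auto
  moreover have "insert None (Some ` (A' \<inter> S)) \<inter> insert None (Some ` S) \<noteq> {}"
    by simp
  moreover have "Some ` (B' \<inter> S) \<inter> insert None (Some ` S) \<noteq> {}"
    using A'B'(6) by auto
  ultimately show False
    using conn E1 E2 unfolding connectedin by meson
qed

context real_pole_function
begin

definition sphere_X :: "sphere set" where
  "sphere_X = insert None (Some ` X)"

lemma ahlfors_competitor_iff:
  "ahlfors_competitor sphere_X f \<longleftrightarrow> (f \<circ> Some) holomorphic_on X \<and> (\<forall>z\<in>X. cmod (f (Some z)) < 1) \<and>
     ((f \<circ> Some) \<longlongrightarrow> 0) at_infinity \<and> f None = 0"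
proof -
  obtain R where "0 < R" "\<And>z. R < cmod z \<Longrightarrow> z \<in> X"
    using exists_radius by blast
  then show ?thesis
    unfolding ahlfors_competitor_def sphere_X_def using sphere_holomorphic_on_iff[OF open_X, of R f]
    by (auto simp: image_subset_iff)
qed

lemma deriv_at_infinity_eq:
  assumes "f None = 0" "((\<lambda>z. z * f (Some z)) \<longlongrightarrow> c) at_infinity"
  shows "deriv_at_infinity f = c"
  unfolding deriv_at_infinity_def using assms by (intro tendsto_Lim[OF trivial_limit_at_infinity]) simp

lemma is_ahlfors_function_iff:
  assumes dom: "sphere_domain sphere_X" and A: "((\<lambda>z. z * r z) \<longlongrightarrow> A) at_infinity"
    and f: "f None = 0" "\<And>z. z \<in> X \<Longrightarrow> f (Some z) = r z"
  shows "is_ahlfors_function sphere_X f \<longleftrightarrow> (\<forall>z. 0 < Im z \<longrightarrow> Im (r z) \<le> 0)"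
proof -
  obtain R where R: "0 < R" "\<And>z. R < cmod z \<Longrightarrow> z \<in> X"
    using exists_radius by blast
  have connected: "connected X"
    by (rule connected_if_connectedin_sphere[OF _ open_X R(2)])
       (use dom in \<open>auto simp: sphere_domain_def sphere_X_def\<close>)
  have near: "eventually (\<lambda>z. f (Some z) = r z) at_infinity"
    using R f(2) by (intro eventually_at_infinityI[of "R + 1"]) auto
  have comp_f: "ahlfors_competitor sphere_X f"
    unfolding ahlfors_competitor_iff
  proof (intro conjI ballI f(1))
    show "(f \<circ> Some) holomorphic_on X"
      by (rule iffD2[OF holomorphic_cong[OF refl] holomorphic_r_X]) (simp add: f(2))
    show "((f \<circ> Some) \<longlongrightarrow> 0) at_infinity"
      by (rule Lim_transform_eventually[OF r_infinity]) (use near in \<open>auto elim: eventually_mono\<close>)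
  qed (simp add: f(2) X_norm_less)
  have "((\<lambda>z. z * f (Some z)) \<longlongrightarrow> A) at_infinity"
    by (rule Lim_transform_eventually[OF A]) (use near in \<open>auto elim: eventually_mono\<close>)
  then have deriv_f: "deriv_at_infinity f = A"
    by (rule deriv_at_infinity_eq[of f A, OF f(1)])
  show ?thesis
  proof
    assume "is_ahlfors_function sphere_X f"
    then have max: "Re (deriv_at_infinity g) \<le> Re A" if "ahlfors_competitor sphere_X g" for g
      using that by (auto simp: is_ahlfors_function_def ahlfors_maximizer_def deriv_f)
    have "Re c \<le> Re A" if g: "g holomorphic_on X" "\<And>z. z \<in> X \<Longrightarrow> cmod (g z) < 1" "(g \<longlongrightarrow> 0) at_infinity"
      "((\<lambda>z. z * g z) \<longlongrightarrow> c) at_infinity" for g c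
    proof -
      define G where "G = (\<lambda>x. case x of None \<Rightarrow> 0 | Some z \<Rightarrow> g z)"
      have "G \<circ> Some = g"
        by (auto simp: G_def)
      then have "ahlfors_competitor sphere_X G"
        unfolding ahlfors_competitor_iff using g by (simp add: G_def)
      moreover have "deriv_at_infinity G = c"
        by (rule deriv_at_infinity_eq) (use g in \<open>simp_all add: G_def\<close>)
      ultimately show ?thesis
        using max by blast
    qed
    then have "Im (r z) \<le> 0" if "z \<in> U" for z
      using Im_r_nonpos_if_maximal[OF connected A _ that] by blast
    then show "\<forall>z. 0 < Im z \<longrightarrow> Im (r z) \<le> 0"
      using Im_r_nonpos_upper_half_plane by blast
  next
    assume nonpos: "\<forall>z. 0 < Im z \<longrightarrow> Im (r z) \<le> 0"
    have U_le: "Im (r z) \<le> 0" if "z \<in> U" for z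
      using nonpos that by (auto simp: U_def)
    \<comment> \<open>Maximality and uniqueness are proved together: equality of the derivatives
      determines the symmetrization of a competitor, and that determines the competitor.\<close>
    have cmp: "Re (deriv_at_infinity g) \<le> Re A \<and>
        (Re (deriv_at_infinity g) = Re A \<longrightarrow> (\<forall>x\<in>sphere_X. g x = f x))"
      if comp: "ahlfors_competitor sphere_X g" for g
    proof -
      have g: "(g \<circ> Some) holomorphic_on X" "\<And>z. z \<in> X \<Longrightarrow> cmod ((g \<circ> Some) z) < 1"
        "((g \<circ> Some) \<longlongrightarrow> 0) at_infinity" "g None = 0"
        using comp unfolding ahlfors_competitor_iff by auto
      obtain c where c: "((\<lambda>z. z * (g \<circ> Some) z) \<longlongrightarrow> c) at_infinity"
        using competitor_derivative_exists[OF g(1,3)] by blast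
      have deriv_g: "deriv_at_infinity g = c"
        using c by (intro deriv_at_infinity_eq g(4)) simp
      from symmetrized_competitor[OF connected U_le A g(1-3) c]
      show ?thesis
      proof
        assume eq: "Re c = Re A \<and> (\<forall>z\<in>X. cayley_log ((g \<circ> Some) z) + cnj (cayley_log ((g \<circ> Some) (cnj z))) =
          2 * cayley_log (r z))"
        then have "(g \<circ> Some) z = r z" if "z \<in> X" for z
          by (intro competitor_eq_if_symmetrization_eq[OF connected g(1-3) _ that]) auto
        then have "\<forall>x\<in>sphere_X. g x = f x"
          using f g(4) by (auto simp: sphere_X_def)
        then show ?thesis
          using eq by (simp add: deriv_g)
      next
        assume "Re c < Re A"
        then show ?thesis
          unfolding deriv_g by linarith
      qed
    qed
    then have "ahlfors_maximizer sphere_X f"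
      using comp_f by (simp add: ahlfors_maximizer_def deriv_f)
    moreover have "\<forall>x\<in>sphere_X. g x = f x" if g: "ahlfors_maximizer sphere_X g" for g
    proof -
      have "ahlfors_competitor sphere_X g" "Re A \<le> Re (deriv_at_infinity g)"
        using g comp_f by (auto simp: ahlfors_maximizer_def deriv_f[symmetric])
      then show ?thesis
        using cmp[of g] by auto
    qed
    moreover have "None \<in> sphere_X"
      by (simp add: sphere_X_def)
    ultimately show "is_ahlfors_function sphere_X f"
      using dom by (auto simp: is_ahlfors_function_def)
  qed
qed

end

section \<open>Values of rational maps at infinity and at poles\<close>

lemma poly_over_power_tendsto:
  fixes Q :: "complex poly"
  assumes "degree Q \<le> d"
  shows "((\<lambda>z. poly Q z / z ^ d) \<longlongrightarrow> coeff Q d) at_infinity"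
proof (cases "degree Q = d")
  case True
  then show ?thesis
    using poly_divide_tendsto_aux[of Q] by simp
next
  case False
  then have "degree Q < degree (monom (1::complex) d)"
    using assms by (simp add: degree_monom_eq)
  from poly_divide_tendsto_0_at_infinity[OF this] show ?thesis
    using False assms by (simp add: poly_monom coeff_eq_0)
qed

text \<open>Nothing is prescribed for the map at infinity itself; its value there is recovered from
  the coefficients. Dividing \<open>P = f * Q\<close> by \<open>z^d\<close> shows that
  \<open>P\<close> has coefficient 0 in every degree \<open>d\<close> that is at least both
  degrees.\<close>

lemma rational_fun_vanishes_at_infinity:
  assumes "Q \<noteq> 0" and lim: "(f \<longlongrightarrow> 0) at_infinity"
    and ev: "eventually (\<lambda>z. rational_fun P Q (Some z) = Some (f z)) at_infinity"
  shows "rational_fun P Q None = Some 0"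
proof -
  have ev': "eventually (\<lambda>z. poly P z = f z * poly Q z) at_infinity"
    using ev by (rule eventually_mono) (auto simp: rational_fun_def nonzero_divide_eq_eq split: if_splits)
  have top: "coeff P d = 0" if "degree P \<le> d" "degree Q \<le> d" for d
  proof -
    have lim0: "((\<lambda>z. f z * (poly Q z / z ^ d)) \<longlongrightarrow> 0) at_infinity"
      using tendsto_mult[OF lim poly_over_power_tendsto[OF that(2)]] by simp
    have "((\<lambda>z. poly P z / z ^ d) \<longlongrightarrow> 0) at_infinity"
      by (rule Lim_transform_eventually[OF lim0]) (use ev' in \<open>auto elim!: eventually_mono\<close>)
    then show ?thesis
      using poly_over_power_tendsto[OF that(1)] tendsto_unique[OF trivial_limit_at_infinity] by blast
  qed
  have "degree P \<le> degree Q"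
  proof (rule ccontr)
    assume "\<not> degree P \<le> degree Q"
    then have "lead_coeff P = 0"
      by (intro top) auto
    then show False
      using \<open>\<not> degree P \<le> degree Q\<close> by simp
  qed
  then show ?thesis
    using top[of "degree Q"] by (simp add: rational_fun_def)
qed

text \<open>The formula for the map omits the poles. If \<open>Q\<close> did not vanish at
  \<open>p\<close>, the quotient would have a finite limit there, against the growth of
  \<open>f\<close>.\<close>

lemma rational_fun_pole:
  assumes inf: "filterlim f at_infinity (at p)"
    and ev: "eventually (\<lambda>z. rational_fun P Q (Some z) = Some (f z)) (at p)"
  shows "rational_fun P Q (Some p) = None"
proof (rule ccontr)
  assume "rational_fun P Q (Some p) \<noteq> None"
  then have "poly Q p \<noteq> 0"
    by (auto simp: rational_fun_def)
  then have "((\<lambda>z. poly P z / poly Q z) \<longlongrightarrow> poly P p / poly Q p) (at p)"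
    by (intro tendsto_intros)
  then have "(f \<longlongrightarrow> poly P p / poly Q p) (at p)"
    by (rule Lim_transform_eventually)
       (use ev in \<open>auto simp: rational_fun_def split: if_splits elim!: eventually_mono\<close>)
  then show False
    by (rule not_tendsto_and_filterlim_at_infinity[OF at_neq_bot _ inf])
qed

lemma filterlim_diff_const_at_infinity: "filterlim (\<lambda>z::complex. z - c) at_infinity at_infinity"
  using tendsto_add_filterlim_at_infinity'[OF filterlim_ident tendsto_const[of "- c"]] by simp

section \<open>Partial fractions with real poles and real residues\<close>

locale real_partial_fractions =
  fixes n :: nat and a p :: "nat \<Rightarrow> real"
  assumes inj_p: "inj_on p {1..n}"
    and a_nonzero: "j \<in> {1..n} \<Longrightarrow> a j \<noteq> 0"
begin

definition poles :: "complex set" where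
  "poles = (\<lambda>j. complex_of_real (p j)) ` {1..n}"

definition fraction :: "complex \<Rightarrow> complex" where
  "fraction z = (\<Sum>j = 1..n. complex_of_real (a j) / (z - complex_of_real (p j)))"

lemma fraction_split:
  assumes "k \<in> {1..n}"
  shows "fraction z = complex_of_real (a k) / (z - complex_of_real (p k)) +
    (\<Sum>j\<in>{1..n} - {k}. complex_of_real (a j) / (z - complex_of_real (p j)))"
  unfolding fraction_def using assms by (intro sum.remove) auto

lemma fraction_rest_tendsto:
  assumes "k \<in> {1..n}" "filterlim f (nhds (complex_of_real (p k))) F"
  shows "((\<lambda>x. \<Sum>j\<in>{1..n} - {k}. complex_of_real (a j) / (f x - complex_of_real (p j))) \<longlongrightarrow>
    (\<Sum>j\<in>{1..n} - {k}. complex_of_real (a j) / (complex_of_real (p k) - complex_of_real (p j)))) F"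
proof (intro tendsto_intros assms(2))
  fix j assume "j \<in> {1..n} - {k}"
  then show "complex_of_real (p k) - complex_of_real (p j) \<noteq> 0"
    using inj_onD[OF inj_p, of k j] assms(1) by auto
qed

sublocale real_pole_function poles fraction
proof
  show "finite poles" "poles \<subseteq> \<real>"
    by (auto simp: poles_def)
  show "fraction holomorphic_on - poles"
    unfolding fraction_def by (intro holomorphic_intros) (auto simp: poles_def)
  show "fraction (cnj z) = cnj (fraction z)" for z
    by (simp add: fraction_def)
  have "((\<lambda>z. complex_of_real (a j) / (z - complex_of_real (p j))) \<longlongrightarrow> 0) at_infinity" for j
    by (intro tendsto_divide_0[OF tendsto_const]) (rule filterlim_diff_const_at_infinity)
  then show "(fraction \<longlongrightarrow> 0) at_infinity"
    unfolding fraction_def by (intro tendsto_null_sum)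
  fix q assume "q \<in> poles"
  then obtain k where k: "k \<in> {1..n}" "q = complex_of_real (p k)"
    by (auto simp: poles_def)
  have "filterlim (\<lambda>z. z - q) (at 0) (at q)"
    by (auto simp: filterlim_at eventually_at_filter intro!: tendsto_eq_intros)
  then have "filterlim (\<lambda>z. complex_of_real (a k) / (z - q)) at_infinity (at q)"
    using a_nonzero[OF k(1)] by (intro filterlim_divide_at_infinity[OF tendsto_const]) auto
  then show "filterlim fraction at_infinity (at q)"
    unfolding fraction_split[OF k(1), abs_def] k(2)
    by (rule tendsto_add_filterlim_at_infinity'[OF _ fraction_rest_tendsto[OF k(1)]]) (simp add: tendsto_ident_at)
qed

lemma fraction_derivative_at_infinity:
  "((\<lambda>z. z * fraction z) \<longlongrightarrow> (\<Sum>j = 1..n. complex_of_real (a j))) at_infinity"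
proof -
  have "((\<lambda>z. z * (complex_of_real (a j) / (z - complex_of_real (p j)))) \<longlongrightarrow> complex_of_real (a j)) at_infinity" for j
  proof -
    have "((\<lambda>z. complex_of_real (a j) + complex_of_real (a j) * complex_of_real (p j) / (z - complex_of_real (p j)))
        \<longlongrightarrow> complex_of_real (a j) + 0) at_infinity"
      by (intro tendsto_intros tendsto_divide_0[OF tendsto_const]) (rule filterlim_diff_const_at_infinity)
    moreover have "eventually (\<lambda>z. complex_of_real (a j) + complex_of_real (a j) * complex_of_real (p j) / (z - complex_of_real (p j))
        = z * (complex_of_real (a j) / (z - complex_of_real (p j)))) at_infinity"
      by (rule eventually_at_infinityI[of "\<bar>p j\<bar> + 1"]) (auto simp: divide_simps algebra_simps)
    ultimately show ?thesis
      by (simp add: Lim_transform_eventually)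
  qed
  then show ?thesis
    unfolding fraction_def sum_distrib_left by (intro tendsto_sum)
qed

lemma Im_fraction_nonpos_iff:
  "(\<forall>z. 0 < Im z \<longrightarrow> Im (fraction z) \<le> 0) \<longleftrightarrow> (\<forall>j\<in>{1..n}. 0 < a j)"
proof
  assume pos: "\<forall>j\<in>{1..n}. 0 < a j"
  have "Im (complex_of_real (a j) / (z - complex_of_real (p j))) \<le> 0" if "0 < Im z" "j \<in> {1..n}" for z j
  proof -
    have "0 \<le> a j * Im z"
      using that pos by (intro mult_nonneg_nonneg) (auto intro: less_imp_le)
    then show ?thesis
      by (simp add: Im_divide)
  qed
  then show "\<forall>z. 0 < Im z \<longrightarrow> Im (fraction z) \<le> 0"
    by (auto simp: fraction_def intro!: sum_nonpos)
next
  assume nonpos: "\<forall>z. 0 < Im z \<longrightarrow> Im (fraction z) \<le> 0"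
  show "\<forall>j\<in>{1..n}. 0 < a j"
  proof
    fix k assume k: "k \<in> {1..n}"
    define rest where "rest = (\<lambda>z. \<Sum>j\<in>{1..n} - {k}. complex_of_real (a j) / (z - complex_of_real (p j)))"
    \<comment> \<open>Approaching the pole vertically from above,
      \<open>y * Im (fraction (s y))\<close> tends to \<open>- a k\<close>, since the remaining
      terms stay bounded. The sign condition thus gives \<open>0 \<le> a k\<close>.\<close>
    define s where "s = (\<lambda>y::real. complex_of_real (p k) + \<i> * complex_of_real y)"
    have "(s \<longlongrightarrow> complex_of_real (p k) + \<i> * complex_of_real 0) (at_right 0)"
      unfolding s_def by (intro tendsto_intros)
    then have "(s \<longlongrightarrow> complex_of_real (p k)) (at_right 0)"
      by simp
    from fraction_rest_tendsto[OF k this]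
    obtain l where "((\<lambda>y. rest (s y)) \<longlongrightarrow> l) (at_right 0)"
      unfolding rest_def by blast
    then have "((\<lambda>y. - a k + y * Im (rest (s y))) \<longlongrightarrow> - a k + 0 * Im l) (at_right 0)"
      by (intro tendsto_intros)
    moreover have "eventually (\<lambda>y. - a k + y * Im (rest (s y)) \<le> 0) (at_right 0)"
      using eventually_at_right_less
    proof (rule eventually_mono)
      fix y :: real assume "0 < y"
      then have "y * Im (fraction (s y)) \<le> 0"
        using nonpos by (intro mult_nonneg_nonpos) (auto simp: s_def)
      moreover have "Im (complex_of_real (a k) / (\<i> * complex_of_real y)) = - a k / y"
        using \<open>0 < y\<close> by (simp add: Im_divide power2_eq_square)
      moreover have "fraction (s y) = complex_of_real (a k) / (\<i> * complex_of_real y) + rest (s y)"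
        unfolding fraction_split[OF k] rest_def by (simp add: s_def)
      ultimately have "y * (- a k / y + Im (rest (s y))) \<le> 0"
        by (simp only: plus_complex.sel)
      moreover have "y * (- a k / y + Im (rest (s y))) = - a k + y * Im (rest (s y))"
        using \<open>0 < y\<close> by (simp add: field_simps)
      ultimately show "- a k + y * Im (rest (s y)) \<le> 0"
        by simp
    qed
    ultimately have "- a k + 0 * Im l \<le> 0"
      by (rule tendsto_upperbound) simp
    then show "0 < a k"
      using a_nonzero[OF k] by simp
  qed
qed

end

theorem theorem1p6:
  fixes n :: nat and a p :: "nat \<Rightarrow> real" and R :: "sphere \<Rightarrow> sphere"
  assumes "rational_map n R"
    and "\<And>z. z \<notin> (\<lambda>j. complex_of_real (p j)) ` {1..n} \<Longrightarrow>
           R (Some z) = Some (\<Sum>j = 1..n. complex_of_real (a j) / (z - complex_of_real (p j)))"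
    and "inj_on p {1..n}"
    and "\<And>j. j \<in> {1..n} \<Longrightarrow> a j \<noteq> 0"
    and "n_connected_domain n (R -` sphere_disk)"
  shows "rational_ahlfors_function R \<longleftrightarrow> (\<forall>j\<in>{1..n}. 0 < a j)"
proof -
  interpret real_partial_fractions n a p
    by unfold_locales (use assms(3,4) in auto)
  have R_Some: "R (Some z) = Some (fraction z)" if "z \<notin> poles" for z
    using assms(2) that by (simp add: poles_def fraction_def)
  obtain P Q where PQ: "Q \<noteq> 0" "R = rational_fun P Q"
    using assms(1) by (auto simp: rational_map_def)
  have ev_inf: "eventually (\<lambda>z. R (Some z) = Some (fraction z)) at_infinity"
  proof -
    obtain b where "0 < b" "\<And>z. b < cmod z \<Longrightarrow> z \<in> X"
      using exists_radius by blast
    then show ?thesis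
      using R_Some by (intro eventually_at_infinityI[of "b + 1"]) (auto simp: X_def)
  qed
  have R_None: "R None = Some 0"
    using rational_fun_vanishes_at_infinity[OF PQ(1) r_infinity, of P] ev_inf PQ(2) by simp
  have R_pole: "R (Some q) = None" if "q \<in> poles" for q
  proof -
    have "eventually (\<lambda>z. z \<in> - (poles - {q})) (at q)"
      using finite_P by (intro eventually_at_in_open' open_Compl finite_imp_closed) auto
    moreover have "eventually (\<lambda>z. z \<noteq> q) (at q)"
      by (simp add: eventually_at_filter)
    ultimately have "eventually (\<lambda>z. R (Some z) = Some (fraction z)) (at q)"
      by eventually_elim (use R_Some in auto)
    then show ?thesis
      using rational_fun_pole[OF pole_r[OF that]] PQ(2) by simp
  qed
  \<comment> \<open>At a pole \<open>fraction\<close> is finite by the division convention while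
    \<open>R\<close> is infinite, so poles are treated separately.\<close>
  have disk: "R -` sphere_disk = sphere_X"
  proof (rule set_eqI)
    fix x show "x \<in> R -` sphere_disk \<longleftrightarrow> x \<in> sphere_X"
    proof (cases x)
      case None
      then show ?thesis
        by (simp add: R_None sphere_X_def sphere_disk_def)
    next
      case (Some z)
      then show ?thesis
        using R_Some[of z] R_pole[of z]
        by (cases "z \<in> poles") (auto simp: sphere_X_def sphere_disk_def X_def)
    qed
  qed
  have dom: "sphere_domain sphere_X" and comps: "has_n_components n (R -` (- sphere_disk))"
    using assms(5) by (auto simp: n_connected_domain_def disk[symmetric] vimage_Compl)
  then have "n_good n R"
    using assms(1) R_None disk by (simp add: n_good_def sphere_domain_def)
  then have "rational_ahlfors_function R \<longleftrightarrow> is_ahlfors_function sphere_X (the \<circ> R)"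
    unfolding rational_ahlfors_function_def disk by blast
  also have "\<dots> \<longleftrightarrow> (\<forall>z. 0 < Im z \<longrightarrow> Im (fraction z) \<le> 0)"
    by (rule is_ahlfors_function_iff[OF dom fraction_derivative_at_infinity])
       (auto simp: R_None R_Some X_def)
  also have "\<dots> \<longleftrightarrow> (\<forall>j\<in>{1..n}. 0 < a j)"
    by (rule Im_fraction_nonpos_iff)
  finally show ?thesis .
qed

end
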